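(* A continuous (linear or nonlinear) operator $G:X\to X^{\odot\star}$ is an admissible perturbation for $\{T_0(t)\}_{t\ge0}$ if and only if $G$ takes its values in $X_0^{\odot\times}$.
   Context: All intervals are non-degenerate but otherwise arbitrary. For a Banach space $E$, $\langle x,x^\star\rangle:=x^\star(x)$ for $x\in E$, $x^\star\in E^\star$. Let $\{T_0(t)\}_{t\ge 0}$ be a $\mathcal{C}_0$-semigroup of bounded linear operators with generator $A_0$ on a Banach space $X$ over $\mathbb{K}\in\{\mathbb{R},\mathbb{C}\}$. The sun dual is $X^\odot:=\{x^\star\in X^\star: \lim_{t\downarrow 0}\|T_0(t)^\star x^\star-x^\star\|=0\}$, a norm-closed subspace of $X^\star$ invariant under all $T_0(t)^\star$; $T_0^\odot(t)$ is the restriction of $T_0(t)^\star$ to $X^\odot$ (a $\mathcal{C}_0$-semigroup, with generator $A_0^\odot$); $X^{\odot\star}:=(X^\odot)^\star$, $T_0^{\odot\star}(t):=(T_0^\odot(t))^\star$, $A_0^{\odot\star}:=(A_0^\odot)^\star$. The canonical embedding $j:X\to X^{\odot\star}$ is $\langle x^\odot,jx\rangle:=\langle x,x^\odot\rangle$; it is injective with norm-closed range $jX$. It is not assumed that $X$ is sun-reflexive. A closed subspace $\mathscr{X}_0$ of $X^{\odot\star}$ is an admissible range for $\{T_0(t)\}$ if, for some (equivalently, for every) interval $J$, for every norm-continuous $f:J\to\mathscr{X}_0$ and all $s\le t$ in $J$ the weak$^\star$ integral $\int_s^tT_0^{\odot\star}(t-\tau)f(\tau)\,d\tau$ belongs to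 $jX$; here $\langle x^\odot,\int_s^tq(\tau)d\tau\rangle:=\int_s^t\langle x^\odot,q(\tau)\rangle d\tau$ for all $x^\odot\in X^\odot$. A continuous operator $G:X\to X^{\odot\star}$ is an admissible perturbation for $\{T_0(t)\}$ if there is an admissible range $\mathscr{X}_0$ for $\{T_0(t)\}$ such that $G$ takes its values in $\mathscr{X}_0$. For $\lambda\in\rho(A_0)=\rho(A_0^{\odot\star})\subseteq\mathbb{K}$ define $X_0^{\odot\times}:=\{x^{\odot\star}\in X^{\odot\star}: R(\lambda,A_0^{\odot\star})x^{\odot\star}\in jX\}$, where $R(\lambda,A_0^{\odot\star}):=(\lambda I-A_0^{\odot\star})^{-1}$; this closed subspace does not depend on the choice of $\lambda$. *)

theory Defs
  imports "HOL-Analysis.Analysis"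
begin

(* The scalar field is a type 'k of sort {real_normed_field, euclidean_space}; by the
   Gelfand-Mazur theorem such a field is isometrically isomorphic to the reals or to the
   complex numbers.  A Banach space over 'k is a type 'a::banach with a scalar
   multiplication by 'k that extends the real one and is compatible with the norm. *)

definition banach_scaling ::
    "('k::{real_normed_field,euclidean_space} \<Rightarrow> 'a::banach \<Rightarrow> 'a) \<Rightarrow> bool" where
  "banach_scaling smul \<longleftrightarrow>
     vector_space smul \<and>
     (\<forall>r x. smul (of_real r) x = r *\<^sub>R x) \<and>
     (\<forall>k x. norm (smul k x) = norm k * norm x)"

lemma banach_scaling_real: "banach_scaling ((*\<^sub>R) :: real \<Rightarrow> 'a::banach \<Rightarrow> 'a)"
  unfolding banach_scaling_def
  by (auto intro!: vector_space.intro simp: algebra_simps)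

lemma banach_scaling_complex: "banach_scaling ((*) :: complex \<Rightarrow> complex \<Rightarrow> complex)"
  unfolding banach_scaling_def
  by (auto intro!: vector_space.intro simp: algebra_simps norm_mult scaleR_conv_of_real)

(* Values of T at negative times are irrelevant. *)
definition c0_semigroup ::
    "('k::{real_normed_field,euclidean_space} \<Rightarrow> 'a::banach \<Rightarrow> 'a) \<Rightarrow> (real \<Rightarrow> 'a \<Rightarrow>\<^sub>L 'a) \<Rightarrow> bool" where
  "c0_semigroup smul T \<longleftrightarrow>
     (\<forall>t\<ge>0. \<forall>k x. T t (smul k x) = smul k (T t x)) \<and>
     T 0 = id_blinfun \<and>
     (\<forall>s\<ge>0. \<forall>t\<ge>0. T (s + t) = T s o\<^sub>L T t) \<and>
     (\<forall>x. ((\<lambda>t. T t x) \<longlongrightarrow> x) (at_right 0))"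

(* Generator of a semigroup S acting on the subspace V of a normed space. *)
definition generator_dom :: "'v::real_normed_vector set \<Rightarrow> (real \<Rightarrow> 'v \<Rightarrow> 'v) \<Rightarrow> 'v set" where
  "generator_dom V S = {x \<in> V. \<exists>y\<in>V. ((\<lambda>h. (S h x - x) /\<^sub>R h) \<longlongrightarrow> y) (at_right 0)}"

definition generator :: "(real \<Rightarrow> 'v \<Rightarrow> 'v) \<Rightarrow> 'v \<Rightarrow> 'v::real_normed_vector" where
  "generator S x = Lim (at_right 0) (\<lambda>h. (S h x - x) /\<^sub>R h)"

definition resolvent_set ::
    "('k \<Rightarrow> 'a \<Rightarrow> 'a) \<Rightarrow> 'a::real_normed_vector set \<Rightarrow> ('a \<Rightarrow> 'a) \<Rightarrow> 'k set" where
  "resolvent_set smul D A =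
     {l. bij_betw (\<lambda>x. smul l x - A x) D UNIV \<and>
         (\<exists>C. \<forall>x\<in>D. norm x \<le> C * norm (smul l x - A x))}"

abbreviation A0_dom :: "(real \<Rightarrow> 'a::banach \<Rightarrow>\<^sub>L 'a) \<Rightarrow> 'a set" where
  "A0_dom T \<equiv> generator_dom UNIV (\<lambda>t. blinfun_apply (T t))"

abbreviation A0 :: "(real \<Rightarrow> 'a::banach \<Rightarrow>\<^sub>L 'a) \<Rightarrow> 'a \<Rightarrow> 'a" where
  "A0 T \<equiv> generator (\<lambda>t. blinfun_apply (T t))"

(* The dual space over 'k: a real-linear bounded map 'a \<Rightarrow> 'k is an element iff it commutes
   with the scalars.  The norm of the blinfun type is the dual norm. *)
definition dual_space ::
    "('k::{real_normed_field,euclidean_space} \<Rightarrow> 'a::banach \<Rightarrow> 'a) \<Rightarrow> ('a \<Rightarrow>\<^sub>L 'k) set" where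
  "dual_space smul = {\<phi> :: 'a \<Rightarrow>\<^sub>L 'k. \<forall>k x. \<phi> (smul k x) = k * \<phi> x}"

definition dual_scale ::
    "'k::{real_normed_field,euclidean_space} \<Rightarrow> ('a::banach \<Rightarrow>\<^sub>L 'k) \<Rightarrow> 'a \<Rightarrow>\<^sub>L 'k" where
  "dual_scale k \<phi> = blinfun_mult_right k o\<^sub>L \<phi>"

definition adj ::
    "(real \<Rightarrow> 'a::banach \<Rightarrow>\<^sub>L 'a) \<Rightarrow> real \<Rightarrow> ('a \<Rightarrow>\<^sub>L 'k) \<Rightarrow> 'a \<Rightarrow>\<^sub>L 'k::{real_normed_field,euclidean_space}" where
  "adj T t \<phi> = \<phi> o\<^sub>L T t"

definition sun_dual ::
    "('k::{real_normed_field,euclidean_space} \<Rightarrow> 'a::banach \<Rightarrow> 'a) \<Rightarrow> (real \<Rightarrow> 'a \<Rightarrow>\<^sub>L 'a) \<Rightarrow> ('a \<Rightarrow>\<^sub>L 'k) set" where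
  "sun_dual smul T =
     {\<phi> \<in> dual_space smul. ((\<lambda>t. norm (adj T t \<phi> - \<phi>)) \<longlongrightarrow> 0) (at_right 0)}"

(* The dual of the sun dual.  Its elements are functions on all of 'a \<Rightarrow>\<^sub>L 'k that are made
   unique by the convention that they vanish outside the sun dual. *)
definition sun_star ::
    "('k::{real_normed_field,euclidean_space} \<Rightarrow> 'a::banach \<Rightarrow> 'a) \<Rightarrow> (real \<Rightarrow> 'a \<Rightarrow>\<^sub>L 'a) \<Rightarrow> (('a \<Rightarrow>\<^sub>L 'k) \<Rightarrow> 'k) set" where
  "sun_star smul T =
     {F. (\<forall>\<phi>. \<phi> \<notin> sun_dual smul T \<longrightarrow> F \<phi> = 0) \<and>
         (\<forall>\<phi>\<in>sun_dual smul T. \<forall>\<psi>\<in>sun_dual smul T. F (\<phi> + \<psi>) = F \<phi> + F \<psi>) \<and>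
         (\<forall>k. \<forall>\<phi>\<in>sun_dual smul T. F (dual_scale k \<phi>) = k * F \<phi>) \<and>
         (\<exists>C. \<forall>\<phi>\<in>sun_dual smul T. norm (F \<phi>) \<le> C * norm \<phi>)}"

definition sun_star_norm ::
    "('k::{real_normed_field,euclidean_space} \<Rightarrow> 'a::banach \<Rightarrow> 'a) \<Rightarrow> (real \<Rightarrow> 'a \<Rightarrow>\<^sub>L 'a) \<Rightarrow> (('a \<Rightarrow>\<^sub>L 'k) \<Rightarrow> 'k) \<Rightarrow> real" where
  "sun_star_norm smul T F = Sup {norm (F \<phi>) |\<phi>. \<phi> \<in> sun_dual smul T \<and> norm \<phi> \<le> 1}"

(* The library's Metric_space wants a nonnegative distance also off the carrier, hence the 0. *)
definition sun_star_dist ::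
    "('k::{real_normed_field,euclidean_space} \<Rightarrow> 'a::banach \<Rightarrow> 'a) \<Rightarrow> (real \<Rightarrow> 'a \<Rightarrow>\<^sub>L 'a)
      \<Rightarrow> (('a \<Rightarrow>\<^sub>L 'k) \<Rightarrow> 'k) \<Rightarrow> (('a \<Rightarrow>\<^sub>L 'k) \<Rightarrow> 'k) \<Rightarrow> real" where
  "sun_star_dist smul T F H =
     (if F \<in> sun_star smul T \<and> H \<in> sun_star smul T
      then sun_star_norm smul T (\<lambda>\<phi>. F \<phi> - H \<phi>) else 0)"

definition sun_star_topology ::
    "('k::{real_normed_field,euclidean_space} \<Rightarrow> 'a::banach \<Rightarrow> 'a) \<Rightarrow> (real \<Rightarrow> 'a \<Rightarrow>\<^sub>L 'a) \<Rightarrow> (('a \<Rightarrow>\<^sub>L 'k) \<Rightarrow> 'k) topology" where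
  "sun_star_topology smul T = Metric_space.mtopology (sun_star smul T) (sun_star_dist smul T)"

lemma sun_dual_scaleR:
  assumes "\<phi> \<in> sun_dual smul T"
  shows "r *\<^sub>R \<phi> \<in> sun_dual smul T"
proof -
  have "adj T t (r *\<^sub>R \<phi>) - r *\<^sub>R \<phi> = r *\<^sub>R (adj T t \<phi> - \<phi>)" for t
    by (rule blinfun_eqI)
       (simp add: adj_def blinfun.diff_left blinfun.scaleR_left scaleR_right_diff_distrib)
  then have "((\<lambda>t. norm (adj T t (r *\<^sub>R \<phi>) - r *\<^sub>R \<phi>)) \<longlongrightarrow> \<bar>r\<bar> * 0) (at_right 0)"
    using assms unfolding sun_dual_def
    by (simp only: norm_scaleR) (intro tendsto_mult_left, simp)
  then show ?thesis
    using assms by (auto simp: sun_dual_def dual_space_def blinfun.scaleR_left)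
qed

lemma Metric_space_sun_star: "Metric_space (sun_star smul T) (sun_star_dist smul T)"
proof -
  let ?S = "\<lambda>F H. {norm (F \<phi> - H \<phi>) |\<phi>. \<phi> \<in> sun_dual smul T \<and> norm \<phi> \<le> 1}"
  have zero: "0 \<in> sun_dual smul T"
    by (simp add: sun_dual_def dual_space_def adj_def)
  have ne: "?S F H \<noteq> {}" for F H
    using zero by fastforce
  have bdd: "bdd_above (?S F H)" if FH: "F \<in> sun_star smul T" "H \<in> sun_star smul T" for F H
  proof -
    obtain C where C: "\<forall>\<phi>\<in>sun_dual smul T. norm (F \<phi>) \<le> C * norm \<phi>"
      using FH(1) by (auto simp: sun_star_def)
    obtain D where D: "\<forall>\<phi>\<in>sun_dual smul T. norm (H \<phi>) \<le> D * norm \<phi>"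
      using FH(2) by (auto simp: sun_star_def)
    have "norm (F \<phi> - H \<phi>) \<le> \<bar>C\<bar> + \<bar>D\<bar>" if p: "\<phi> \<in> sun_dual smul T" "norm \<phi> \<le> 1" for \<phi>
    proof -
      have "c * norm \<phi> \<le> \<bar>c\<bar>" for c :: real
        using p(2) mult_mono[of c "\<bar>c\<bar>" "norm \<phi>" 1] by simp
      then show ?thesis
        using bspec[OF C p(1)] bspec[OF D p(1)] norm_triangle_ineq4[of "F \<phi>" "H \<phi>"] by (smt (verit))
    qed
    then show ?thesis
      by (auto simp: bdd_above_def)
  qed
  have le: "norm (F \<phi> - H \<phi>) \<le> sun_star_dist smul T F H"
    if "F \<in> sun_star smul T" "H \<in> sun_star smul T" "\<phi> \<in> sun_dual smul T" "norm \<phi> \<le> 1" for F H \<phi>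
    unfolding sun_star_dist_def sun_star_norm_def
    using that(1,2) by (simp only: simp_thms if_True)
      (rule cSup_upper[OF _ bdd[OF that(1,2)]], use that in auto)
  have bound: "sun_star_dist smul T F H \<le> c"
    if "F \<in> sun_star smul T" "H \<in> sun_star smul T"
      "\<And>\<phi>. \<phi> \<in> sun_dual smul T \<Longrightarrow> norm \<phi> \<le> 1 \<Longrightarrow> norm (F \<phi> - H \<phi>) \<le> c" for F H c
    using that ne[of F H] unfolding sun_star_dist_def sun_star_norm_def
    by (auto intro!: cSup_least)
  show ?thesis
  proof
    fix F H
    show "sun_star_dist smul T F H = sun_star_dist smul T H F"
      by (simp add: sun_star_dist_def sun_star_norm_def norm_minus_commute)
    show "0 \<le> sun_star_dist smul T F H"
    proof (cases "F \<in> sun_star smul T \<and> H \<in> sun_star smul T")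
      case True
      then have "norm (F 0 - H 0) \<le> sun_star_dist smul T F H"
        using zero by (intro le) auto
      then show ?thesis
        by (meson norm_ge_zero order_trans)
    qed (auto simp: sun_star_dist_def)
  next
    fix F H
    assume FH: "F \<in> sun_star smul T" "H \<in> sun_star smul T"
    show "sun_star_dist smul T F H = 0 \<longleftrightarrow> F = H"
    proof
      assume 0: "sun_star_dist smul T F H = 0"
      have scale_eq: "E (r *\<^sub>R \<phi>) = r *\<^sub>R E \<phi>"
        if "E \<in> sun_star smul T" "\<phi> \<in> sun_dual smul T" for E r \<phi>
      proof -
        have "r *\<^sub>R \<phi> = dual_scale (of_real r) \<phi>"
          by (rule blinfun_eqI) (simp add: dual_scale_def blinfun.scaleR_left scaleR_conv_of_real)
        then show ?thesis
          using that by (simp add: sun_star_def scaleR_conv_of_real)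
      qed
      show "F = H"
      proof
        fix \<phi>
        show "F \<phi> = H \<phi>"
        proof (cases "\<phi> \<in> sun_dual smul T")
          case True
          define r where "r = inverse (norm \<phi> + 1)"
          have r: "r > 0"
            using norm_ge_zero[of \<phi>] by (simp add: r_def add_nonneg_pos)
          have "norm (r *\<^sub>R \<phi>) \<le> 1"
          proof -
            have "r * norm \<phi> \<le> r * (norm \<phi> + 1)"
              using r by (intro mult_left_mono) auto
            also have "r * (norm \<phi> + 1) = 1"
              unfolding r_def using norm_ge_zero[of \<phi>] by (intro left_inverse) linarith
            finally show ?thesis
              using r by simp
          qed
          then have "norm (F (r *\<^sub>R \<phi>) - H (r *\<^sub>R \<phi>)) \<le> 0"
            using le[OF FH sun_dual_scaleR[OF True]] 0 by simp
          then show ?thesis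
            using r by (simp add: scale_eq[OF FH(1) True] scale_eq[OF FH(2) True])
        next
          case False
          then show ?thesis
            using FH by (simp add: sun_star_def)
        qed
      qed
    next
      assume "F = H"
      then have "sun_star_dist smul T F H \<le> 0"
        using FH by (intro bound) auto
      moreover have "norm (F 0 - H 0) \<le> sun_star_dist smul T F H"
        using zero FH by (intro le) auto
      ultimately show "sun_star_dist smul T F H = 0"
        using \<open>F = H\<close> by simp
    qed
  next
    fix F H E
    assume "F \<in> sun_star smul T" "H \<in> sun_star smul T" "E \<in> sun_star smul T"
    note FHE = this
    have "norm (F \<phi> - E \<phi>) \<le> sun_star_dist smul T F H + sun_star_dist smul T H E"
      if "\<phi> \<in> sun_dual smul T" "norm \<phi> \<le> 1" for \<phi>
    proof -
      have "norm (F \<phi> - E \<phi>) \<le> norm (F \<phi> - H \<phi>) + norm (H \<phi> - E \<phi>)"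
        using norm_triangle_ineq[of "F \<phi> - H \<phi>" "H \<phi> - E \<phi>"] by simp
      also have "\<dots> \<le> sun_star_dist smul T F H + sun_star_dist smul T H E"
        using FHE that by (intro add_mono le)
      finally show ?thesis .
    qed
    then show "sun_star_dist smul T F E \<le> sun_star_dist smul T F H + sun_star_dist smul T H E"
      using FHE by (intro bound)
  qed
qed

definition sun_star_semigroup ::
    "('k::{real_normed_field,euclidean_space} \<Rightarrow> 'a::banach \<Rightarrow> 'a) \<Rightarrow> (real \<Rightarrow> 'a \<Rightarrow>\<^sub>L 'a)
      \<Rightarrow> real \<Rightarrow> (('a \<Rightarrow>\<^sub>L 'k) \<Rightarrow> 'k) \<Rightarrow> ('a \<Rightarrow>\<^sub>L 'k) \<Rightarrow> 'k" where
  "sun_star_semigroup smul T t F =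
     (\<lambda>\<phi>. if \<phi> \<in> sun_dual smul T then F (adj T t \<phi>) else 0)"

definition sun_embed ::
    "('k::{real_normed_field,euclidean_space} \<Rightarrow> 'a::banach \<Rightarrow> 'a) \<Rightarrow> (real \<Rightarrow> 'a \<Rightarrow>\<^sub>L 'a)
      \<Rightarrow> 'a \<Rightarrow> ('a \<Rightarrow>\<^sub>L 'k) \<Rightarrow> 'k" where
  "sun_embed smul T x = (\<lambda>\<phi>. if \<phi> \<in> sun_dual smul T then \<phi> x else 0)"

definition weak_star_integral ::
    "('k::{real_normed_field,euclidean_space} \<Rightarrow> 'a::banach \<Rightarrow> 'a) \<Rightarrow> (real \<Rightarrow> 'a \<Rightarrow>\<^sub>L 'a)
      \<Rightarrow> real \<Rightarrow> real \<Rightarrow> (real \<Rightarrow> ('a \<Rightarrow>\<^sub>L 'k) \<Rightarrow> 'k) \<Rightarrow> ('a \<Rightarrow>\<^sub>L 'k) \<Rightarrow> 'k" where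
  "weak_star_integral smul T s t q =
     (\<lambda>\<phi>. if \<phi> \<in> sun_dual smul T then integral {s..t} (\<lambda>\<tau>. q \<tau> \<phi>) else 0)"

definition closed_subspace_sun_star ::
    "('k::{real_normed_field,euclidean_space} \<Rightarrow> 'a::banach \<Rightarrow> 'a) \<Rightarrow> (real \<Rightarrow> 'a \<Rightarrow>\<^sub>L 'a)
      \<Rightarrow> (('a \<Rightarrow>\<^sub>L 'k) \<Rightarrow> 'k) set \<Rightarrow> bool" where
  "closed_subspace_sun_star smul T W \<longleftrightarrow>
     W \<subseteq> sun_star smul T \<and>
     (\<lambda>\<phi>. 0) \<in> W \<and>
     (\<forall>F\<in>W. \<forall>H\<in>W. (\<lambda>\<phi>. F \<phi> + H \<phi>) \<in> W) \<and>
     (\<forall>k. \<forall>F\<in>W. (\<lambda>\<phi>. k * F \<phi>) \<in> W) \<and>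
     closedin (sun_star_topology smul T) W"

definition admissible_range ::
    "('k::{real_normed_field,euclidean_space} \<Rightarrow> 'a::banach \<Rightarrow> 'a) \<Rightarrow> (real \<Rightarrow> 'a \<Rightarrow>\<^sub>L 'a)
      \<Rightarrow> (('a \<Rightarrow>\<^sub>L 'k) \<Rightarrow> 'k) set \<Rightarrow> bool" where
  "admissible_range smul T W \<longleftrightarrow>
     closed_subspace_sun_star smul T W \<and>
     (\<exists>J. is_interval J \<and> (\<exists>a\<in>J. \<exists>b\<in>J. a < b) \<and>
       (\<forall>f. continuous_map (top_of_set J) (sun_star_topology smul T) f \<and> f ` J \<subseteq> W \<longrightarrow>
         (\<forall>s\<in>J. \<forall>t\<in>J. s \<le> t \<longrightarrow>
           weak_star_integral smul T s t (\<lambda>\<tau>. sun_star_semigroup smul T (t - \<tau>) (f \<tau>))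
             \<in> range (sun_embed smul T))))"

definition admissible_perturbation ::
    "('k::{real_normed_field,euclidean_space} \<Rightarrow> 'a::banach \<Rightarrow> 'a) \<Rightarrow> (real \<Rightarrow> 'a \<Rightarrow>\<^sub>L 'a)
      \<Rightarrow> ('a \<Rightarrow> ('a \<Rightarrow>\<^sub>L 'k) \<Rightarrow> 'k) \<Rightarrow> bool" where
  "admissible_perturbation smul T G \<longleftrightarrow>
     continuous_map euclidean (sun_star_topology smul T) G \<and>
     (\<exists>W. admissible_range smul T W \<and> range G \<subseteq> W)"

(* The generator of the restriction of the adjoint semigroup to the sun dual. *)
abbreviation A0_sun_dom ::
    "('k::{real_normed_field,euclidean_space} \<Rightarrow> 'a::banach \<Rightarrow> 'a) \<Rightarrow> (real \<Rightarrow> 'a \<Rightarrow>\<^sub>L 'a) \<Rightarrow> ('a \<Rightarrow>\<^sub>L 'k) set" where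
  "A0_sun_dom smul T \<equiv> generator_dom (sun_dual smul T) (adj T)"

abbreviation A0_sun ::
    "(real \<Rightarrow> 'a::banach \<Rightarrow>\<^sub>L 'a) \<Rightarrow> ('a \<Rightarrow>\<^sub>L 'k) \<Rightarrow> 'a \<Rightarrow>\<^sub>L 'k::{real_normed_field,euclidean_space}" where
  "A0_sun T \<equiv> generator (adj T)"

(* H is the value at F of the adjoint of the generator on the sun dual; it is unique since
   that generator is densely defined. *)
definition A0_sun_star_rel ::
    "('k::{real_normed_field,euclidean_space} \<Rightarrow> 'a::banach \<Rightarrow> 'a) \<Rightarrow> (real \<Rightarrow> 'a \<Rightarrow>\<^sub>L 'a)
      \<Rightarrow> (('a \<Rightarrow>\<^sub>L 'k) \<Rightarrow> 'k) \<Rightarrow> (('a \<Rightarrow>\<^sub>L 'k) \<Rightarrow> 'k) \<Rightarrow> bool" where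
  "A0_sun_star_rel smul T F H \<longleftrightarrow>
     F \<in> sun_star smul T \<and> H \<in> sun_star smul T \<and>
     (\<forall>\<phi>\<in>A0_sun_dom smul T. H \<phi> = F (A0_sun T \<phi>))"

definition A0_sun_star_dom ::
    "('k::{real_normed_field,euclidean_space} \<Rightarrow> 'a::banach \<Rightarrow> 'a) \<Rightarrow> (real \<Rightarrow> 'a \<Rightarrow>\<^sub>L 'a)
      \<Rightarrow> (('a \<Rightarrow>\<^sub>L 'k) \<Rightarrow> 'k) set" where
  "A0_sun_star_dom smul T = {F. \<exists>H. A0_sun_star_rel smul T F H}"

definition A0_sun_star ::
    "('k::{real_normed_field,euclidean_space} \<Rightarrow> 'a::banach \<Rightarrow> 'a) \<Rightarrow> (real \<Rightarrow> 'a \<Rightarrow>\<^sub>L 'a)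
      \<Rightarrow> (('a \<Rightarrow>\<^sub>L 'k) \<Rightarrow> 'k) \<Rightarrow> ('a \<Rightarrow>\<^sub>L 'k) \<Rightarrow> 'k" where
  "A0_sun_star smul T F = (THE H. A0_sun_star_rel smul T F H)"

definition sun_star_resolvent ::
    "('k::{real_normed_field,euclidean_space} \<Rightarrow> 'a::banach \<Rightarrow> 'a) \<Rightarrow> (real \<Rightarrow> 'a \<Rightarrow>\<^sub>L 'a)
      \<Rightarrow> 'k \<Rightarrow> (('a \<Rightarrow>\<^sub>L 'k) \<Rightarrow> 'k) \<Rightarrow> ('a \<Rightarrow>\<^sub>L 'k) \<Rightarrow> 'k" where
  "sun_star_resolvent smul T l =
     inv_into (A0_sun_star_dom smul T) (\<lambda>F \<phi>. l * F \<phi> - A0_sun_star smul T F \<phi>)"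

definition sun_cross ::
    "('k::{real_normed_field,euclidean_space} \<Rightarrow> 'a::banach \<Rightarrow> 'a) \<Rightarrow> (real \<Rightarrow> 'a \<Rightarrow>\<^sub>L 'a)
      \<Rightarrow> 'k \<Rightarrow> (('a \<Rightarrow>\<^sub>L 'k) \<Rightarrow> 'k) set" where
  "sun_cross smul T l =
     {F \<in> sun_star smul T. sun_star_resolvent smul T l F \<in> range (sun_embed smul T)}"

end

theory Submission
  imports Defs
begin

text \<open>
  Write \<open>R\<close> for the resolvent of \<open>A\<^sub>0\<close> at \<open>l\<close> and \<open>j\<close> for the embedding of \<open>X\<close> into the dual of
  the sun dual.  Since the orbits of vectors in the domain are locally Lipschitz, the operator norm of
  \<open>T h \<circ> R - R\<close> is of order \<open>h\<close>; hence the adjoint \<open>\<phi> \<mapsto> \<phi> \<circ> R\<close> maps the whole dual space into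
  the sun dual, where it is the resolvent of the generator.  Dualising once more, the resolvent on
  the dual of the sun dual is \<open>F \<mapsto> (\<phi> \<mapsto> F (\<phi> \<circ> R))\<close>.  So \<open>F\<close> lies in \<open>sun_cross\<close> iff there is a
  \<open>z\<close> in \<open>X\<close> with \<open>F (\<phi> \<circ> R) = \<phi> z\<close> for all \<open>\<phi>\<close> in the sun dual (\<open>sun_cross_iff\<close>), and both
  directions of the theorem become statements about this identity.

  Let \<open>F\<close> belong to an admissible range, and use the constant function \<open>F\<close>.  The integral of its
  orbit over a time interval of small length \<open>h\<close> is some \<open>j u\<close>, so \<open>R u / h\<close> represents the average
  over times in \<open>{0..h}\<close> of the orbit of \<open>\<phi> \<mapsto> F (\<phi> \<circ> R)\<close>.  By the estimate on \<open>T h \<circ> R - R\<close> these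
  averages tend in norm to \<open>\<phi> \<mapsto> F (\<phi> \<circ> R)\<close> itself, which therefore lies in the closed set
  \<open>range j\<close> (\<open>sun_cross_if_short_integrals\<close>).

  Conversely, \<open>sun_cross\<close> is itself an admissible range.  If \<open>F (\<phi> \<circ> R) = \<phi> z\<close>, then formally
  \<open>F = (l - A) j z\<close>, and the integral of the orbit of \<open>F\<close> over \<open>{a..b}\<close> is the image under \<open>j\<close> of
  \<open>l (\<integral> T (t - \<tau>) z d\<tau>) - (T (t - a) z - T (t - b) z)\<close> (\<open>sun_cross_orbit_int\<close>).  A continuous
  function with values in \<open>sun_cross\<close> is nearly constant on short intervals, so its orbit integral is
  a limit of elements of \<open>range j\<close> (\<open>orbit_integral_approx\<close>).  The set \<open>sun_cross\<close> is closed because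
  \<open>R\<close> is bounded and \<open>range j\<close> is closed.

  That \<open>range j\<close> is closed (\<open>embed_range_closed\<close>) rests on the fact that the sun dual determines the
  norm of \<open>X\<close> up to a constant (\<open>sun_norming\<close>): a norm-attaining functional is given by the
  Hahn-Banach theorem, and averaging it along the semigroup over a short time moves it into the sun
  dual.
\<close>

section \<open>Norm-attaining real functionals\<close>

text \<open>
  For nonnegative factors the inequality implies equality (\<open>sublinear_scaleR\<close>); the inequality is
  what infima inherit directly.
\<close>
definition sublinear :: "('a::real_normed_vector \<Rightarrow> real) \<Rightarrow> bool" where
  "sublinear p \<longleftrightarrow> (\<forall>x y. p (x + y) \<le> p x + p y) \<and> (\<forall>r\<ge>0. \<forall>x. p (r *\<^sub>R x) \<le> r * p x)"

lemma sublinear_add: "sublinear p \<Longrightarrow> p (x + y) \<le> p x + p y"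
  by (simp add: sublinear_def)

lemma sublinear_scaleR:
  assumes "sublinear p" "r \<ge> 0"
  shows "p (r *\<^sub>R x) = r * p x"
proof (cases "r = 0")
  case True
  have "p (0 *\<^sub>R 0) \<le> 0 * p 0"
    using assms(1) unfolding sublinear_def by blast
  moreover have "p 0 \<le> p 0 + p 0"
    using sublinear_add[OF assms(1), of 0 0] by simp
  ultimately have "p 0 = 0" by simp
  with True show ?thesis by simp
next
  case False
  with assms have r: "r > 0" by simp
  have "p (inverse r *\<^sub>R (r *\<^sub>R x)) \<le> inverse r * p (r *\<^sub>R x)"
    using assms(1) r unfolding sublinear_def by (meson inverse_nonnegative_iff_nonnegative less_imp_le)
  then have "r * p x \<le> p (r *\<^sub>R x)"
    using r by (simp add: field_simps)
  then show ?thesis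
    using assms unfolding sublinear_def by (meson antisym)
qed

lemma sublinear_lower_bound: "sublinear p \<Longrightarrow> - p (- x) \<le> p x"
  using sublinear_add[of p x "- x"] sublinear_scaleR[of p 0 0] by simp

text \<open>
  The largest sublinear minorant of a sublinear \<open>p\<close> whose value at \<open>- y\<close> is at most \<open>- p y\<close>; for a \<open>p\<close> that is
  linear along \<open>y\<close> it is \<open>p\<close> itself.
\<close>
definition tilt :: "('a::real_normed_vector \<Rightarrow> real) \<Rightarrow> 'a \<Rightarrow> 'a \<Rightarrow> real" where
  "tilt p y x = (INF t\<in>{0..}. p (x + t *\<^sub>R y) - t * p y)"

lemma tilt_le:
  assumes p: "sublinear p" and t: "t \<ge> 0"
  shows "tilt p y x \<le> p (x + t *\<^sub>R y) - t * p y"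
  unfolding tilt_def
proof (rule cINF_lower)
  have "- p (- x) \<le> p (x + r *\<^sub>R y) - r * p y" if "r \<ge> 0" for r
    using sublinear_add[OF p, of "x + r *\<^sub>R y" "- x"] sublinear_scaleR[OF p that, of y] by simp
  then show "bdd_below ((\<lambda>t. p (x + t *\<^sub>R y) - t * p y) ` {0..})"
    by (intro bdd_belowI2[where m = "- p (- x)"]) simp
qed (use t in simp)

lemma le_tilt:
  assumes "\<And>t. t \<ge> 0 \<Longrightarrow> c \<le> p (x + t *\<^sub>R y) - t * p y"
  shows "c \<le> tilt p y x"
  unfolding tilt_def by (rule cINF_greatest) (use assms in auto)

lemma sublinear_tilt:
  assumes p: "sublinear p"
  shows "sublinear (tilt p y)"
  unfolding sublinear_def
proof safe
  fix x z
  have *: "tilt p y (x + z) \<le> (p (x + s *\<^sub>R y) - s * p y) + (p (z + t *\<^sub>R y) - t * p y)"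
    if "s \<ge> 0" "t \<ge> 0" for s t
    using tilt_le[OF p, of "s + t" y "x + z"] that
      sublinear_add[OF p, of "x + s *\<^sub>R y" "z + t *\<^sub>R y"]
    by (simp add: algebra_simps)
  have "tilt p y (x + z) - (p (z + t *\<^sub>R y) - t * p y) \<le> tilt p y x" if "t \<ge> 0" for t
    by (rule le_tilt) (use *[OF _ that] in \<open>simp add: algebra_simps\<close>)
  then have "tilt p y (x + z) - tilt p y x \<le> tilt p y z"
    by (intro le_tilt) (simp add: algebra_simps)
  then show "tilt p y (x + z) \<le> tilt p y x + tilt p y z"
    by simp
next
  fix r :: real and x
  assume r: "r \<ge> 0"
  have *: "tilt p y (r *\<^sub>R x) \<le> r * (p (x + t *\<^sub>R y) - t * p y)" if "t \<ge> 0" for t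
    using tilt_le[OF p, of "r * t" y "r *\<^sub>R x"] that r sublinear_scaleR[OF p r, of "x + t *\<^sub>R y"]
    by (simp add: algebra_simps)
  show "tilt p y (r *\<^sub>R x) \<le> r * tilt p y x"
  proof (cases "r = 0")
    case True
    with *[of 0] show ?thesis by simp
  next
    case False
    with r have "tilt p y (r *\<^sub>R x) / r \<le> tilt p y x"
      by (intro le_tilt) (use * in \<open>simp add: field_simps\<close>)
    with False r show ?thesis by (simp add: field_simps)
  qed
qed

text \<open>
  Zorn's lemma: the pointwise infimum of a chain of sublinear functionals is again sublinear, because
  of any two members of a chain one lies below both.  The bound \<open>- p (- x)\<close> keeps the infimum finite.
\<close>
lemma minimal_sublinear_exists:
  fixes p :: "'a::real_normed_vector \<Rightarrow> real"
  assumes p: "sublinear p"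
  obtains u where "sublinear u" "u \<le> p" "\<And>v. sublinear v \<Longrightarrow> v \<le> u \<Longrightarrow> v = u"
proof -
  let ?A = "{u. sublinear u \<and> u \<le> p}"
  let ?R = "\<lambda>u v :: 'a \<Rightarrow> real. v \<le> u"
  have "partial_order_on ?A (relation_of ?R ?A)"
    by (rule partial_order_on_relation_ofI) auto
  moreover have "\<exists>u\<in>?A. \<forall>v\<in>C. u \<le> v" if C: "C \<in> Chains (relation_of ?R ?A)" for C
  proof (cases "C = {}")
    case True
    with p show ?thesis by auto
  next
    case False
    have CA: "C \<subseteq> ?A" and cmp: "\<And>u v. u \<in> C \<Longrightarrow> v \<in> C \<Longrightarrow> u \<le> v \<or> v \<le> u"
      using C by (auto simp: Chains_def relation_of_def)
    define u where "u x = (INF v\<in>C. v x)" for x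
    have le: "u x \<le> v x" if "v \<in> C" for v x
      unfolding u_def
    proof (rule cINF_lower[OF _ that])
      have "- p (- x) \<le> w x" if "w \<in> C" for w
      proof -
        have "sublinear w" "w (- x) \<le> p (- x)"
          using CA that by (auto simp: le_fun_def)
        then show ?thesis using sublinear_lower_bound[of w x] by simp
      qed
      then show "bdd_below ((\<lambda>v. v x) ` C)"
        by (rule bdd_belowI2)
    qed
    have ge: "c \<le> u x" if "\<And>v. v \<in> C \<Longrightarrow> c \<le> v x" for c x
      unfolding u_def by (rule cINF_greatest[OF False that])
    have "u (x + y) \<le> v x + w y" if "v \<in> C" "w \<in> C" for v w x y
    proof -
      obtain z where z: "z \<in> C" "z \<le> v" "z \<le> w"
        using cmp[of v w] \<open>v \<in> C\<close> \<open>w \<in> C\<close> by auto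
      have "u (x + y) \<le> z (x + y)" by (rule le[OF z(1)])
      also have "\<dots> \<le> z x + z y" using z(1) CA sublinear_add by blast
      also have "\<dots> \<le> v x + w y" using z(2,3) by (intro add_mono) (auto simp: le_fun_def)
      finally show ?thesis .
    qed
    then have "u (x + y) - w y \<le> u x" if "w \<in> C" for w x y
      using that by (intro ge) (simp add: algebra_simps)
    then have "u (x + y) - u x \<le> u y" for x y
      by (intro ge) (simp add: algebra_simps)
    moreover have "u (r *\<^sub>R x) \<le> r * u x" if r: "r \<ge> 0" for r x
    proof -
      have *: "u (r *\<^sub>R x) \<le> r * v x" if "v \<in> C" for v
        using le[OF that, of "r *\<^sub>R x"] CA that sublinear_scaleR[of v r x] r by auto
      show ?thesis
      proof (cases "r = 0")
        case True
        with * False show ?thesis by auto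
      next
        case nz: False
        with r have "u (r *\<^sub>R x) / r \<le> u x"
          by (intro ge) (use * in \<open>simp add: field_simps\<close>)
        with nz r show ?thesis by (simp add: field_simps)
      qed
    qed
    ultimately have "sublinear u"
      by (simp add: sublinear_def algebra_simps)
    moreover have "u \<le> p"
    proof (rule le_funI)
      fix x
      obtain v where "v \<in> C" using False by auto
      then have "u x \<le> v x" and "v \<le> p" using le CA by auto
      then show "u x \<le> p x" by (simp add: le_fun_def) (meson order_trans)
    qed
    ultimately show ?thesis
      using le by (auto simp: le_fun_def)
  qed
  ultimately obtain u where "u \<in> ?A" "\<forall>v\<in>?A. v \<le> u \<longrightarrow> v = u"
    using predicate_Zorn[of ?A ?R] by blast
  then show thesis
    by (intro that[of u]) auto
qed

text \<open>
  Minimal sublinear functionals are linear, since tilting in any direction \<open>y\<close> cannot decrease them.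
  This yields the Hahn-Banach theorem.
\<close>
lemma minimal_sublinear_additive:
  assumes u: "sublinear u" and min: "\<And>v. sublinear v \<Longrightarrow> v \<le> u \<Longrightarrow> v = u"
  shows "u (x + y) = u x + u y"
proof -
  have "tilt u y = u"
    using tilt_le[OF u, of 0 y] by (intro min sublinear_tilt u) (auto simp: le_fun_def)
  then have "u x \<le> u (x + y) - u y"
    using tilt_le[OF u, of 1 y x] by simp
  with sublinear_add[OF u, of x y] show ?thesis by simp
qed

text \<open>
  Tilting the norm in the direction \<open>x0\<close> before minimising forces the value \<open>- norm x0\<close> at \<open>- x0\<close>.
\<close>
lemma real_norming_functional:
  fixes x0 :: "'a::real_normed_vector"
  obtains u :: "'a \<Rightarrow> real" where "bounded_linear u" "\<And>x. \<bar>u x\<bar> \<le> norm x" "u x0 = norm x0"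
proof -
  have n: "sublinear (norm :: 'a \<Rightarrow> real)"
    by (simp add: sublinear_def norm_triangle_ineq)
  obtain u where u: "sublinear u" "u \<le> tilt norm x0"
    and min: "\<And>v. sublinear v \<Longrightarrow> v \<le> u \<Longrightarrow> v = u"
    using minimal_sublinear_exists[OF sublinear_tilt[OF n]] by blast
  have add: "u (x + y) = u x + u y" for x y
    by (rule minimal_sublinear_additive[OF u(1) min])
  have minus: "u (- x) = - u x" for x
    using add[of x "- x"] sublinear_scaleR[OF u(1), of 0 0] by simp
  have scale: "u (r *\<^sub>R x) = r * u x" for r x
    using sublinear_scaleR[OF u(1), of r x] sublinear_scaleR[OF u(1), of "- r" x] minus[of "r *\<^sub>R x"]
    by (cases "r \<ge> 0") auto
  have "u x \<le> norm x" for x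
    using u(2) tilt_le[OF n, of 0 x0 x] by (simp add: le_fun_def) (meson order_trans)
  from this this[of "- _"] have bound: "\<bar>u x\<bar> \<le> norm x" for x
    by (simp add: minus abs_le_iff)
  have "u (- x0) \<le> - norm x0"
    using u(2) tilt_le[OF n, of 1 x0 "- x0"] by (simp add: le_fun_def) (metis order_trans)
  with bound[of x0] have "u x0 = norm x0"
    by (simp add: minus)
  moreover have "bounded_linear u"
    by (rule bounded_linear_intro[where K = 1]) (use add scale bound in auto)
  ultimately show thesis
    using bound that by blast
qed

section \<open>Functionals that are linear over the scalar field\<close>

text \<open>
  Complex conjugation, expressed through the norm so that it makes sense in every scalar field
  considered here; on the reals it is the identity.
\<close>
definition field_conj :: "'k::{real_normed_field,euclidean_space} \<Rightarrow> 'k" where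
  "field_conj d = (norm d)\<^sup>2 *\<^sub>R inverse d"

text \<open>Multiplication by \<open>d\<close> scales the norm by \<open>norm d\<close>, and polarisation transfers this to the inner product.\<close>
lemma inner_mult_both:
  fixes x y d :: "'k::{real_normed_field,euclidean_space}"
  shows "inner (x * d) (y * d) = (norm d)\<^sup>2 * inner x y"
proof -
  have *: "(norm (z * d))\<^sup>2 = (norm d)\<^sup>2 * (norm z)\<^sup>2" for z :: 'k
    by (simp add: norm_mult power_mult_distrib)
  have "2 * inner (x * d) (y * d) = (norm ((x + y) * d))\<^sup>2 - (norm (x * d))\<^sup>2 - (norm (y * d))\<^sup>2"
    using dot_norm[of "x * d" "y * d"] by (simp add: distrib_right)
  also have "\<dots> = (norm d)\<^sup>2 * ((norm (x + y))\<^sup>2 - (norm x)\<^sup>2 - (norm y)\<^sup>2)"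
    unfolding * by (simp add: right_diff_distrib)
  also have "(norm (x + y))\<^sup>2 - (norm x)\<^sup>2 - (norm y)\<^sup>2 = 2 * inner x y"
    using dot_norm[of x y] by simp
  finally show ?thesis
    by simp
qed

lemma inner_mult_conj:
  fixes a c d :: "'k::{real_normed_field,euclidean_space}"
  shows "inner a (d * c) = inner (field_conj d * a) c"
proof (cases "d = 0")
  case False
  have "inner a (d * c) = inner ((a * inverse d) * d) (c * d)"
    using False by (simp add: mult.assoc mult.commute[of c])
  also have "\<dots> = inner (field_conj d * a) c"
    unfolding inner_mult_both by (simp add: field_conj_def mult.commute)
  finally show ?thesis .
qed (simp add: field_conj_def)

lemma field_conj_mult: "field_conj (a * b) = field_conj a * field_conj b"
  by (simp add: field_conj_def norm_mult power_mult_distrib)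

lemma field_conj_1 [simp]: "field_conj 1 = 1"
  by (simp add: field_conj_def)

lemma norm_field_conj [simp]: "norm (field_conj d) = norm d"
  by (cases "d = 0") (simp_all add: field_conj_def norm_inverse power2_eq_square)

lemma field_conj_conj [simp]: "field_conj (field_conj d) = d"
proof (cases "d = 0")
  case False
  then have "field_conj (field_conj d) = (norm d)\<^sup>2 *\<^sub>R inverse ((norm d)\<^sup>2 *\<^sub>R inverse d)"
    using norm_field_conj[of d] by (simp add: field_conj_def)
  with False show ?thesis
    by (simp add: inverse_scaleR_distrib)
qed (simp add: field_conj_def)

text \<open>
  Additivity is not visible from the formula; it comes from \<open>inner_mult_conj\<close>, by which \<open>field_conj d\<close>
  represents the real functional \<open>c \<mapsto> inner 1 (d * c)\<close>.
\<close>
lemma linear_field_conj: "linear (field_conj :: 'k::{real_normed_field,euclidean_space} \<Rightarrow> 'k)"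
proof -
  have conj: "inner (field_conj d) c = inner 1 (d * c)" for c d :: 'k
    using inner_mult_conj[of 1 d c] by simp
  then have *: "field_conj d = x" if "\<And>c. inner x c = inner 1 (d * c)" for x d :: 'k
    using that vector_eq_rdot[of x "field_conj d"] by simp
  show ?thesis
    by (intro linearI; rule *) (simp_all add: conj inner_add_left inner_add_right distrib_right)
qed

locale scaled_banach =
  fixes smul :: "'k::{real_normed_field,euclidean_space} \<Rightarrow> 'a::banach \<Rightarrow> 'a"
  assumes scaling: "banach_scaling smul"
begin

sublocale smul: vector_space smul
  using scaling by (simp add: banach_scaling_def)

lemma smul_of_real: "smul (of_real r) x = r *\<^sub>R x"
  and norm_smul: "norm (smul k x) = norm k * norm x"
  using scaling by (auto simp: banach_scaling_def)

lemma smul_scaleR: "smul (r *\<^sub>R k) x = r *\<^sub>R smul k x"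
  by (metis smul.scale_scale scaleR_conv_of_real smul_of_real)

lemma bounded_linear_smul: "bounded_linear (smul k)"
proof (rule bounded_linear_intro)
  show "smul k (r *\<^sub>R x) = r *\<^sub>R smul k x" for r x
    by (metis mult.commute smul.scale_scale smul_of_real)
  show "norm (smul k x) \<le> norm x * norm k" for x
    by (simp add: norm_smul)
qed (rule smul.scale_right_distrib)

text \<open>
  A real functional \<open>u\<close> is turned into one over the scalar field by taking for \<open>\<Phi> x\<close> the Riesz
  representative of \<open>c \<mapsto> u (smul (field_conj c) x)\<close>.  Over the complex numbers this is the familiar
  \<open>u x - \<i> u (\<i> x)\<close>.  Testing at \<open>c = \<Phi> x\<close> bounds the norm, and at \<open>c = 1\<close> shows that it is attained.
\<close>
lemma norming_functional:
  obtains \<phi> :: "'a \<Rightarrow>\<^sub>L 'k" where "\<phi> \<in> dual_space smul" "norm \<phi> \<le> 1" "norm x0 \<le> norm (\<phi> x0)"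
proof -
  obtain u :: "'a \<Rightarrow> real" where u: "bounded_linear u" "\<And>x. \<bar>u x\<bar> \<le> norm x" "u x0 = norm x0"
    using real_norming_functional[of x0] by blast
  interpret u: bounded_linear u by fact
  define \<Phi> where "\<Phi> x = adjoint (\<lambda>c. u (smul (field_conj c) x)) 1" for x
  have "linear (\<lambda>c. u (smul (field_conj c) x))" for x
    using linear_field_conj[where 'k = 'k]
    by (intro linearI)
      (simp_all add: linear_add linear_scale smul.scale_left_distrib smul_scaleR u.add u.scaleR)
  then have \<Phi>: "inner (\<Phi> x) c = u (smul (field_conj c) x)" for x c
    unfolding \<Phi>_def using adjoint_works[of "\<lambda>c. u (smul (field_conj c) x)" c 1] by (simp add: inner_commute)
  then have \<Phi>I: "y = \<Phi> x" if "\<And>c. inner y c = u (smul (field_conj c) x)" for x y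
    by (metis that vector_eq_rdot)
  have add: "\<Phi> (x + y) = \<Phi> x + \<Phi> y" for x y
    by (rule \<Phi>I[symmetric]) (simp add: \<Phi> inner_add_left u.add smul.scale_right_distrib)
  have scale: "\<Phi> (smul d x) = d * \<Phi> x" for d x
  proof (rule \<Phi>I[symmetric])
    show "inner (d * \<Phi> x) c = u (smul (field_conj c) (smul d x))" for c
      using inner_mult_conj[of "\<Phi> x" "field_conj d" c, symmetric]
      by (simp add: \<Phi> field_conj_mult mult.commute)
  qed
  have bound: "norm (\<Phi> x) \<le> norm x" for x
  proof -
    have "norm (\<Phi> x) * norm (\<Phi> x) = u (smul (field_conj (\<Phi> x)) x)"
      using \<Phi>[of x "\<Phi> x"] by (simp only: power2_norm_eq_inner flip: power2_eq_square)
    also have "\<dots> \<le> norm (\<Phi> x) * norm x"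
      using u(2)[of "smul (field_conj (\<Phi> x)) x"] by (simp add: norm_smul)
    finally show ?thesis
      by (cases "\<Phi> x = 0") auto
  qed
  have bl: "bounded_linear \<Phi>"
    using scale[of "of_real _"] bound
    by (intro bounded_linear_intro[where K = 1]) (auto simp: add smul_of_real scaleR_conv_of_real)
  show thesis
  proof (rule that[of "Blinfun \<Phi>"])
    show "Blinfun \<Phi> \<in> dual_space smul"
      by (simp add: dual_space_def bounded_linear_Blinfun_apply[OF bl] scale)
    show "norm (Blinfun \<Phi>) \<le> 1"
      by (rule norm_blinfun_bound) (simp_all add: bounded_linear_Blinfun_apply[OF bl] bound)
    show "norm x0 \<le> norm (Blinfun \<Phi> x0)"
      using \<Phi>[of x0 1] u(3) Cauchy_Schwarz_ineq2[of "\<Phi> x0" 1]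
      by (simp add: bounded_linear_Blinfun_apply[OF bl])
  qed
qed

end

section \<open>Right increments, averages and integrals on subspaces\<close>

lemma continuous_on_right_modulus:
  fixes f :: "real \<Rightarrow> 'b::real_normed_vector"
  assumes g: "(g \<longlongrightarrow> 0) (at_right 0)"
    and le: "\<And>r s. 0 \<le> r \<Longrightarrow> r < s \<Longrightarrow> s \<le> c \<Longrightarrow> norm (f s - f r) \<le> g (s - r)"
  shows "continuous_on {0..c} f"
  unfolding continuous_on_iff
proof safe
  fix x e :: real
  assume x: "x \<in> {0..c}" and e: "e > 0"
  from tendstoD[OF g e] obtain d where d: "d > 0" "\<And>h. 0 < h \<Longrightarrow> h < d \<Longrightarrow> \<bar>g h\<bar> < e"
    by (auto simp: eventually_at_right_field dist_real_def)
  have "norm (f y - f x) < e" if "y \<in> {0..c}" "\<bar>y - x\<bar> < d" for y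
    using le[of x y] le[of y x] d(2)[of "y - x"] d(2)[of "x - y"] that x e
    by (cases y x rule: linorder_cases) (auto simp: norm_minus_commute)
  with d(1) show "\<exists>d>0. \<forall>y\<in>{0..c}. dist y x < d \<longrightarrow> dist (f y) (f x) < e"
    by (auto simp: dist_norm)
qed

text \<open>
  A bound on forward increments that is uniform in the base point also controls backward increments,
  at the cost of moving the derivative from the left end point to \<open>x\<close>; continuity of \<open>v\<close> pays for this.
\<close>
lemma vector_derivative_from_right_increments:
  fixes u v :: "real \<Rightarrow> 'b::real_normed_vector"
  assumes v: "continuous_on {0..c} v"
    and w: "(\<omega> \<longlongrightarrow> 0) (at_right 0)"
    and le: "\<And>r s. 0 \<le> r \<Longrightarrow> r < s \<Longrightarrow> s \<le> c \<Longrightarrow>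
      norm (u s - u r - (s - r) *\<^sub>R v r) \<le> (s - r) * \<omega> (s - r)"
    and x: "x \<in> {0..c}"
  shows "(u has_vector_derivative v x) (at x within {0..c})"
  unfolding has_vector_derivative_def has_derivative_within_alt
proof (intro conjI allI impI)
  show "bounded_linear (\<lambda>h. h *\<^sub>R v x)"
    by (rule bounded_linear_scaleR_left)
  fix e :: real
  assume e: "e > 0"
  then have "e / 2 > 0" by simp
  from tendstoD[OF w this] obtain d where d: "d > 0" "\<And>h. 0 < h \<Longrightarrow> h < d \<Longrightarrow> \<bar>\<omega> h\<bar> < e / 2"
    by (auto simp: eventually_at_right_field dist_real_def)
  from v x \<open>e / 2 > 0\<close> obtain d' where d': "d' > 0"
      "\<And>y. y \<in> {0..c} \<Longrightarrow> \<bar>y - x\<bar> < d' \<Longrightarrow> norm (v y - v x) < e / 2"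
    unfolding continuous_on_iff dist_norm real_norm_def by metis
  have "norm (u y - u x - (y - x) *\<^sub>R v x) \<le> e * norm (y - x)"
    if y: "y \<in> {0..c}" "\<bar>y - x\<bar> < min d d'" for y
  proof (cases y x rule: linorder_cases)
    case less
    have "u y - u x - (y - x) *\<^sub>R v x = - (u x - u y - (x - y) *\<^sub>R v y) - (x - y) *\<^sub>R (v y - v x)"
      by (simp add: algebra_simps)
    then have "norm (u y - u x - (y - x) *\<^sub>R v x)
        \<le> norm (u x - u y - (x - y) *\<^sub>R v y) + norm ((x - y) *\<^sub>R (v y - v x))"
      by (metis norm_minus_cancel norm_triangle_ineq4)
    also have "\<dots> \<le> (x - y) * (e / 2) + (x - y) * (e / 2)"
    proof (rule add_mono)
      have "(x - y) * \<omega> (x - y) \<le> (x - y) * (e / 2)"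
        using d(2)[of "x - y"] less y by (intro mult_left_mono) auto
      with le[of y x] less x y show "norm (u x - u y - (x - y) *\<^sub>R v y) \<le> (x - y) * (e / 2)"
        by (meson atLeastAtMost_iff order_trans)
      show "norm ((x - y) *\<^sub>R (v y - v x)) \<le> (x - y) * (e / 2)"
        using d'(2)[of y] less y by simp
    qed
    finally show ?thesis
      using less by (simp add: algebra_simps)
  next
    case greater
    have "(y - x) * \<omega> (y - x) \<le> (y - x) * e"
      using d(2)[of "y - x"] greater y e by (intro mult_left_mono) auto
    with le[of x y] greater x y have "norm (u y - u x - (y - x) *\<^sub>R v x) \<le> (y - x) * e"
      by (meson atLeastAtMost_iff order_trans)
    with greater show ?thesis
      by (simp add: mult.commute)
  qed simp
  with d(1) d'(1) show "\<exists>d>0. \<forall>y\<in>{0..c}. norm (y - x) < d \<longrightarrow>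
      norm (u y - u x - (y - x) *\<^sub>R v x) \<le> e * norm (y - x)"
    by (intro exI[of _ "min d d'"]) auto
qed

lemma average_at_right_0:
  fixes f :: "real \<Rightarrow> 'b::banach"
  assumes f: "continuous_on {0..1} f"
  shows "((\<lambda>h. integral {0..h} (\<lambda>\<tau>. f (h - \<tau>)) /\<^sub>R h) \<longlongrightarrow> f 0) (at_right 0)"
proof (rule tendstoI)
  fix e :: real
  assume e: "e > 0"
  then have "e / 2 > 0" by simp
  with f obtain d where d: "d > 0" "\<And>s. 0 \<le> s \<Longrightarrow> s \<le> 1 \<Longrightarrow> s < d \<Longrightarrow> norm (f s - f 0) < e / 2"
    unfolding continuous_on_iff dist_norm real_norm_def
    by (metis abs_of_nonneg atLeastAtMost_iff diff_zero order_refl zero_le_one)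
  have "dist (integral {0..h} (\<lambda>\<tau>. f (h - \<tau>)) /\<^sub>R h) (f 0) < e"
    if h: "0 < h" "h < min d 1" for h
  proof -
    have cont: "continuous_on {0..h} (\<lambda>\<tau>. f (h - \<tau>))"
      by (rule continuous_on_compose2[OF f]) (use h in \<open>auto intro!: continuous_intros\<close>)
    have "integral {0..h} (\<lambda>\<tau>. f (h - \<tau>) - f 0) = integral {0..h} (\<lambda>\<tau>. f (h - \<tau>)) - h *\<^sub>R f 0"
      using h by (subst integral_diff) (auto intro: integrable_continuous_real cont)
    moreover have "norm (integral {0..h} (\<lambda>\<tau>. f (h - \<tau>) - f 0)) \<le> e / 2 * (h - 0)"
      using h d by (intro integral_bound continuous_intros cont) (auto intro: less_imp_le)
    ultimately have "norm (integral {0..h} (\<lambda>\<tau>. f (h - \<tau>)) - h *\<^sub>R f 0) \<le> e / 2 * h"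
      by simp
    then have "inverse h * norm (integral {0..h} (\<lambda>\<tau>. f (h - \<tau>)) - h *\<^sub>R f 0) \<le> inverse h * (e / 2 * h)"
      using h by (intro mult_left_mono) auto
    also have "\<dots> = e / 2" using h by simp
    also have "inverse h * norm (integral {0..h} (\<lambda>\<tau>. f (h - \<tau>)) - h *\<^sub>R f 0)
        = norm (inverse h *\<^sub>R (integral {0..h} (\<lambda>\<tau>. f (h - \<tau>)) - h *\<^sub>R f 0))"
      using h by simp
    also have "\<dots> = dist (integral {0..h} (\<lambda>\<tau>. f (h - \<tau>)) /\<^sub>R h) (f 0)"
      using h by (simp add: dist_norm scaleR_diff_right)
    finally show ?thesis using e by simp
  qed
  then show "\<forall>\<^sub>F h in at_right 0. dist (integral {0..h} (\<lambda>\<tau>. f (h - \<tau>)) /\<^sub>R h) (f 0) < e"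
    unfolding eventually_at_right_field using d(1) by (intro exI[of _ "min d 1"]) auto
qed

text \<open>
  \<open>F\<close> is bounded and linear only on the subspace \<open>S\<close>, so it cannot be exchanged with the integral as
  an operator on the whole space.  Instead \<open>F\<close> is applied to the indefinite integral, whose derivative
  survives because \<open>F\<close> is Lipschitz on \<open>S\<close>, and the result is integrated again.
\<close>
lemma integral_linear_on_subspace:
  fixes g :: "real \<Rightarrow> 'b::banach" and F :: "'b \<Rightarrow> 'c::banach"
  assumes ab: "a \<le> b" and g: "continuous_on {a..b} g"
    and S: "subspace S" "\<And>r. a \<le> r \<Longrightarrow> r \<le> b \<Longrightarrow> g r \<in> S"
      "\<And>r. a \<le> r \<Longrightarrow> r \<le> b \<Longrightarrow> integral {a..r} g \<in> S"
    and F: "\<And>x y. x \<in> S \<Longrightarrow> y \<in> S \<Longrightarrow> F (x + y) = F x + F y"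
      "\<And>r x. x \<in> S \<Longrightarrow> F (r *\<^sub>R x) = r *\<^sub>R F x"
      "\<And>x. x \<in> S \<Longrightarrow> norm (F x) \<le> C * norm x"
  shows "((\<lambda>r. F (g r)) has_integral F (integral {a..b} g)) {a..b}"
proof -
  have F_diff: "F (x - y) = F x - F y" if "x \<in> S" "y \<in> S" for x y
    using F(1)[OF that(1), of "- y"] F(2)[OF that(2), of "- 1"] subspace_neg[OF S(1) that(2)] by simp
  have C: "norm (F x) \<le> (\<bar>C\<bar> + 1) * norm x" if "x \<in> S" for x
    using F(3)[OF that] mult_right_mono[of C "\<bar>C\<bar> + 1" "norm x"] by force
  have "((\<lambda>r. F (integral {a..r} g)) has_vector_derivative F (g x)) (at x within {a..b})"
    if x: "x \<in> {a..b}" for x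
    unfolding has_vector_derivative_def has_derivative_within_alt
  proof (intro conjI allI impI)
    show "bounded_linear (\<lambda>h. h *\<^sub>R F (g x))"
      by (rule bounded_linear_scaleR_left)
    fix e :: real
    assume "e > 0"
    then have e: "e / (\<bar>C\<bar> + 1) > 0"
      by (intro divide_pos_pos) auto
    obtain d where d: "d > 0" "\<And>y. y \<in> {a..b} \<Longrightarrow> norm (y - x) < d \<Longrightarrow>
        norm (integral {a..y} g - integral {a..x} g - (y - x) *\<^sub>R g x) \<le> e / (\<bar>C\<bar> + 1) * norm (y - x)"
      using integral_has_vector_derivative[OF g x] e
      unfolding has_vector_derivative_def has_derivative_within_alt by meson
    have "norm (F (integral {a..y} g) - F (integral {a..x} g) - (y - x) *\<^sub>R F (g x)) \<le> e * norm (y - x)"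
      if y: "y \<in> {a..b}" "norm (y - x) < d" for y
    proof -
      let ?D = "integral {a..y} g - integral {a..x} g - (y - x) *\<^sub>R g x"
      have "?D \<in> S" and eq: "F ?D = F (integral {a..y} g) - F (integral {a..x} g) - (y - x) *\<^sub>R F (g x)"
        using x y S by (simp_all add: F_diff F(2) subspace_diff subspace_scale)
      have "norm (F ?D) \<le> (\<bar>C\<bar> + 1) * norm ?D"
        by (rule C) fact
      also have "\<dots> \<le> (\<bar>C\<bar> + 1) * (e / (\<bar>C\<bar> + 1) * norm (y - x))"
        by (intro mult_left_mono d y) auto
      also have "\<dots> = e * norm (y - x)"
        by (simp add: add_nonneg_eq_0_iff)
      finally show ?thesis unfolding eq .
    qed
    with d(1) show "\<exists>d>0. \<forall>y\<in>{a..b}. norm (y - x) < d \<longrightarrow>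
        norm (F (integral {a..y} g) - F (integral {a..x} g) - (y - x) *\<^sub>R F (g x)) \<le> e * norm (y - x)"
      by blast
  qed
  from fundamental_theorem_of_calculus[OF ab this]
  show ?thesis
    using F(2)[of 0 0] subspace_0[OF S(1)] by simp
qed

section \<open>Generators and semigroup orbits\<close>

lemma generator_tendsto:
  assumes "x \<in> generator_dom V S"
  shows "((\<lambda>h. (S h x - x) /\<^sub>R h) \<longlongrightarrow> generator S x) (at_right 0)"
  using assms unfolding generator_dom_def generator_def
  by (auto simp: tendsto_Lim)

lemma generator_eqI:
  "((\<lambda>h. (S h x - x) /\<^sub>R h) \<longlongrightarrow> y) (at_right 0) \<Longrightarrow> generator S x = y"
  unfolding generator_def by (simp add: tendsto_Lim)

lemma generator_domI:
  "x \<in> V \<Longrightarrow> y \<in> V \<Longrightarrow> ((\<lambda>h. (S h x - x) /\<^sub>R h) \<longlongrightarrow> y) (at_right 0) \<Longrightarrow> x \<in> generator_dom V S"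
  unfolding generator_dom_def by blast

lemma generator_in: "x \<in> generator_dom V S \<Longrightarrow> generator S x \<in> V"
  unfolding generator_dom_def using generator_eqI by fastforce

locale scaled_semigroup = scaled_banach smul
  for smul :: "'k::{real_normed_field,euclidean_space} \<Rightarrow> 'a::banach \<Rightarrow> 'a" +
  fixes T :: "real \<Rightarrow> 'a \<Rightarrow>\<^sub>L 'a"
  assumes c0: "c0_semigroup smul T"
begin

lemma T_smul: "t \<ge> 0 \<Longrightarrow> T t (smul k x) = smul k (T t x)"
  and T_0 [simp]: "T 0 = id_blinfun"
  and T_add: "s \<ge> 0 \<Longrightarrow> t \<ge> 0 \<Longrightarrow> T (s + t) = T s o\<^sub>L T t"
  and T_tendsto: "((\<lambda>t. T t x) \<longlongrightarrow> x) (at_right 0)"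
  using c0 by (auto simp: c0_semigroup_def)

lemma T_T: "s \<ge> 0 \<Longrightarrow> t \<ge> 0 \<Longrightarrow> T s (T t x) = T (s + t) x"
  by (simp add: T_add)

lemma T_commute: "s \<ge> 0 \<Longrightarrow> t \<ge> 0 \<Longrightarrow> T s (T t x) = T t (T s x)"
  by (simp add: T_T add.commute)

text \<open>
  Uniform boundedness: every orbit is bounded near time 0, so by Baire's theorem some set \<open>C n\<close> of
  vectors with a common bound \<open>n\<close> on a common time interval contains a ball.
\<close>
lemma T_bounded_near_0: "\<exists>d>0. \<exists>M. \<forall>t\<in>{0..d}. norm (T t) \<le> M"
proof -
  define C where "C n = {x. \<forall>t\<in>{0..inverse (real (Suc n))}. norm (T t x) \<le> real n}" for n
  have "closed (C n)" for n
  proof -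
    have "C n = (\<Inter>t\<in>{0..inverse (real (Suc n))}. {x. norm (T t x) \<le> real n})"
      by (auto simp: C_def)
    then show ?thesis
      by (auto intro!: closed_Collect_le continuous_intros)
  qed
  moreover have "x \<in> (\<Union>n. C n)" for x
  proof -
    from tendstoD[OF T_tendsto[of x], of 1]
    obtain d where d: "d > 0" "\<And>t. 0 < t \<Longrightarrow> t < d \<Longrightarrow> dist (T t x) x < 1"
      by (auto simp: eventually_at_right_field)
    obtain n1 where n1: "inverse (real (Suc n1)) < d"
      using reals_Archimedean[OF d(1)] by blast
    obtain n2 where n2: "norm x + 1 \<le> real n2"
      using real_arch_simple by blast
    define n where "n = max n1 n2"
    have "inverse (real (Suc n)) \<le> inverse (real (Suc n1))"
      unfolding n_def by (intro le_imp_inverse_le) auto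
    moreover have "norm (T t x) \<le> norm x + 1" if "0 \<le> t" "t < d" for t
    proof (cases "t = 0")
      case False
      with that d(2)[of t] have "norm (T t x - x) < 1" by (simp add: dist_norm)
      with norm_triangle_sub[of "T t x" x] show ?thesis by simp
    qed simp
    moreover have "real n2 \<le> real n" by (simp add: n_def)
    ultimately have "x \<in> C n"
      using n1 n2 unfolding C_def by (smt (verit) atLeastAtMost_iff mem_Collect_eq)
    then show ?thesis by blast
  qed
  then have "\<Union>(range C) = UNIV" by blast
  ultimately obtain n where "interior (C n) \<noteq> {}"
    using Baire_category_alt[of "euclidean :: 'a topology" "range C"]
    by (auto simp: completely_metrizable_space_euclidean)
  then obtain x0 where "x0 \<in> interior (C n)" by blast
  then obtain r where r: "r > 0" "cball x0 r \<subseteq> C n"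
    by (meson mem_interior_cball)
  have "norm (T t) \<le> 2 * real n / r" if t: "t \<in> {0..inverse (real (Suc n))}" for t
  proof (rule norm_blinfun_bound)
    fix y
    show "norm (T t y) \<le> 2 * real n / r * norm y"
    proof (cases "y = 0")
      case False
      define z where "z = (r / norm y) *\<^sub>R y"
      have "x0 + z \<in> cball x0 r" "x0 \<in> cball x0 r"
        using r(1) False by (auto simp: z_def dist_norm)
      with r(2) have "x0 + z \<in> C n" "x0 \<in> C n"
        by blast+
      then have "norm (T t (x0 + z)) \<le> n" "norm (T t x0) \<le> n"
        using t by (auto simp: C_def)
      then have "norm (T t z) \<le> 2 * real n"
        using norm_triangle_ineq4[of "T t (x0 + z)" "T t x0"] by (simp add: blinfun.add_right)
      then have "r / norm y * norm (T t y) \<le> 2 * real n"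
        using r(1) by (simp add: z_def blinfun.scaleR_right)
      then show ?thesis
        using r(1) False by (simp add: field_simps)
    qed simp
  qed (use r in simp)
  moreover have "inverse (real (Suc n)) > 0" by simp
  ultimately show ?thesis by blast
qed

text \<open>By the semigroup law a bound \<open>M \<ge> 1\<close> on \<open>{0..d}\<close> becomes its \<open>n\<close>-th power on \<open>{0..n * d}\<close>.\<close>
lemma T_locally_bounded:
  obtains M where "M > 0" "\<And>t. 0 \<le> t \<Longrightarrow> t \<le> c \<Longrightarrow> norm (T t) \<le> M"
proof -
  obtain d M0 where d: "d > 0" and M0: "\<And>t. t \<in> {0..d} \<Longrightarrow> norm (T t) \<le> M0"
    using T_bounded_near_0 by blast
  define M where "M = max 1 M0"
  have M: "M \<ge> 1" "\<And>t. t \<in> {0..d} \<Longrightarrow> norm (T t) \<le> M"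
    using M0 by (auto simp: M_def intro: max.coboundedI2)
  have bound: "norm (T t) \<le> M ^ Suc n" if "0 \<le> t" "t \<le> real (Suc n) * d" for n t
    using that
  proof (induction n arbitrary: t)
    case 0
    with M show ?case by simp
  next
    case (Suc n)
    show ?case
    proof (cases "t \<le> d")
      case True
      have "M ^ 1 \<le> M ^ Suc (Suc n)" using M(1) by (intro power_increasing) auto
      with True Suc.prems M(2)[of t] show ?thesis by simp
    next
      case False
      have "norm (T (d + (t - d))) \<le> norm (T d) * norm (T (t - d))"
        using False d by (subst T_add) (auto simp: norm_blinfun_compose)
      also have "\<dots> \<le> M * M ^ Suc n"
        using M Suc.prems False d by (intro mult_mono Suc.IH) (auto simp: algebra_simps)
      finally show ?thesis by simp
    qed
  qed
  obtain n where "c / d \<le> real n"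
    using real_arch_simple by blast
  then have "c \<le> real (Suc n) * d"
    using d by (simp add: field_simps)
  with bound have "norm (T t) \<le> M ^ Suc n" if "0 \<le> t" "t \<le> c" for t
    using that by force
  with M(1) show thesis
    by (intro that[of "M ^ Suc n"]) auto
qed

lemma continuous_T: "continuous_on {0..c} (\<lambda>t. T t x)"
proof -
  obtain M where M: "M > 0" "\<And>t. 0 \<le> t \<Longrightarrow> t \<le> c \<Longrightarrow> norm (T t) \<le> M"
    using T_locally_bounded by blast
  show ?thesis
  proof (rule continuous_on_right_modulus)
    have "((\<lambda>h. M * norm (T h x - x)) \<longlongrightarrow> M * norm (x - x)) (at_right 0)"
      by (intro tendsto_intros T_tendsto)
    then show "((\<lambda>h. M * norm (T h x - x)) \<longlongrightarrow> 0) (at_right 0)" by simp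
    fix r s :: real
    assume rs: "0 \<le> r" "r < s" "s \<le> c"
    have "T s x - T r x = T r (T (s - r) x - x)"
      using rs by (simp add: blinfun.diff_right T_T)
    also have "norm \<dots> \<le> norm (T r) * norm (T (s - r) x - x)"
      by (rule norm_blinfun)
    also have "\<dots> \<le> M * norm (T (s - r) x - x)"
      using rs M by (intro mult_right_mono) auto
    finally show "norm (T s x - T r x) \<le> M * norm (T (s - r) x - x)" .
  qed
qed

lemma continuous_T_reversed: "b \<le> t \<Longrightarrow> continuous_on {a..b} (\<lambda>\<tau>. T (t - \<tau>) x)"
  by (rule continuous_on_compose2[OF continuous_T[of "t - a"]]) (auto intro!: continuous_intros)

lemma integrable_T_reversed: "b \<le> t \<Longrightarrow> (\<lambda>\<tau>. T (t - \<tau>) x) integrable_on {a..b}"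
  by (intro integrable_continuous_real continuous_T_reversed)

lemma A0_tendsto: "w \<in> A0_dom T \<Longrightarrow> ((\<lambda>h. (T h w - w) /\<^sub>R h) \<longlongrightarrow> A0 T w) (at_right 0)"
  by (rule generator_tendsto)

text \<open>The generator only provides right derivatives at time 0; the semigroup law turns them into uniform forward increments.\<close>
lemma orbit_derivative:
  assumes w: "w \<in> A0_dom T" and x: "x \<in> {0..c}"
  shows "((\<lambda>t. T t w) has_vector_derivative T x (A0 T w)) (at x within {0..c})"
proof -
  obtain M where M: "M > 0" "\<And>t. 0 \<le> t \<Longrightarrow> t \<le> c \<Longrightarrow> norm (T t) \<le> M"
    using T_locally_bounded by blast
  let ?e = "\<lambda>h. M * norm ((T h w - w) /\<^sub>R h - A0 T w)"
  show ?thesis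
  proof (rule vector_derivative_from_right_increments[OF continuous_T _ _ x])
    have "(?e \<longlongrightarrow> M * norm (A0 T w - A0 T w)) (at_right 0)"
      by (intro tendsto_intros A0_tendsto w)
    then show "(?e \<longlongrightarrow> 0) (at_right 0)" by simp
    fix r s :: real
    assume rs: "0 \<le> r" "r < s" "s \<le> c"
    have "T s w - T r w - (s - r) *\<^sub>R T r (A0 T w)
        = T r ((s - r) *\<^sub>R ((T (s - r) w - w) /\<^sub>R (s - r) - A0 T w))"
      using rs by (simp add: blinfun.diff_right blinfun.scaleR_right T_T scaleR_diff_right)
    also have "norm \<dots> \<le> norm (T r) * norm ((s - r) *\<^sub>R ((T (s - r) w - w) /\<^sub>R (s - r) - A0 T w))"
      by (rule norm_blinfun)
    also have "\<dots> \<le> M * norm ((s - r) *\<^sub>R ((T (s - r) w - w) /\<^sub>R (s - r) - A0 T w))"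
      using rs M by (intro mult_right_mono) auto
    also have "\<dots> = (s - r) * ?e (s - r)"
      using rs by simp
    finally show "norm (T s w - T r w - (s - r) *\<^sub>R T r (A0 T w)) \<le> (s - r) * ?e (s - r)" .
  qed
qed

lemma integral_orbit_generator:
  assumes w: "w \<in> A0_dom T" and ab: "a \<le> b" "b \<le> t"
  shows "((\<lambda>\<tau>. T (t - \<tau>) (A0 T w)) has_integral (T (t - a) w - T (t - b) w)) {a..b}"
proof -
  have "((\<lambda>\<tau>. - T (t - \<tau>) w) has_vector_derivative T (t - x) (A0 T w)) (at x within {a..b})"
    if x: "x \<in> {a..b}" for x
  proof -
    have "((\<lambda>\<tau>. t - \<tau>) has_vector_derivative - 1) (at x within {a..b})"
      by (auto intro!: derivative_eq_intros)
    moreover have "((\<lambda>s. T s w) has_vector_derivative T (t - x) (A0 T w))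
        (at (t - x) within (\<lambda>\<tau>. t - \<tau>) ` {a..b})"
      by (rule has_vector_derivative_within_subset[OF orbit_derivative[OF w, of _ "t - a"]])
        (use x ab in auto)
    ultimately have "((\<lambda>s. T s w) \<circ> (\<lambda>\<tau>. t - \<tau>) has_vector_derivative - 1 *\<^sub>R T (t - x) (A0 T w))
        (at x within {a..b})"
      by (rule vector_diff_chain_within)
    then show ?thesis
      using has_vector_derivative_minus[of "\<lambda>\<tau>. T (t - \<tau>) w"] by (fastforce simp: o_def)
  qed
  from fundamental_theorem_of_calculus[OF ab(1) this] show ?thesis by simp
qed

text \<open>
  The strong integral of \<open>T (t - \<tau>)\<close> over \<open>\<tau>\<close> in \<open>{a..b}\<close>, meaningful for \<open>a \<le> b \<le> t\<close>.  The reversed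
  time argument is the one of the convolution integrals in the definition of admissibility.
\<close>
definition orbit_int :: "real \<Rightarrow> real \<Rightarrow> real \<Rightarrow> 'a \<Rightarrow>\<^sub>L 'a" where
  "orbit_int t a b = Blinfun (\<lambda>x. integral {a..b} (\<lambda>\<tau>. T (t - \<tau>) x))"

lemma integral_T_bound:
  assumes "a \<le> b" "b \<le> t" "\<And>s. 0 \<le> s \<Longrightarrow> s \<le> t - a \<Longrightarrow> norm (T s) \<le> M"
  shows "norm (integral {a..b} (\<lambda>\<tau>. T (t - \<tau>) x)) \<le> M * (b - a) * norm x"
proof -
  have "norm (integral {a..b} (\<lambda>\<tau>. T (t - \<tau>) x)) \<le> M * norm x * (b - a)"
  proof (rule integral_bound[OF assms(1) continuous_T_reversed[OF assms(2)]])
    fix \<tau> assume "\<tau> \<in> {a..b}"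
    then show "norm (T (t - \<tau>) x) \<le> M * norm x"
      using assms by (intro order_trans[OF norm_blinfun mult_right_mono]) auto
  qed
  then show ?thesis by (simp add: mult_ac)
qed

lemma orbit_int_apply:
  assumes "a \<le> b" "b \<le> t"
  shows "orbit_int t a b x = integral {a..b} (\<lambda>\<tau>. T (t - \<tau>) x)"
proof -
  obtain M where M: "M > 0" "\<And>s. 0 \<le> s \<Longrightarrow> s \<le> t - a \<Longrightarrow> norm (T s) \<le> M"
    using T_locally_bounded by blast
  have "bounded_linear (\<lambda>x. integral {a..b} (\<lambda>\<tau>. T (t - \<tau>) x))"
    using assms
    by (intro bounded_linear_intro[where K = "M * (b - a)"])
      (auto simp: blinfun.add_right blinfun.scaleR_right integrable_T_reversed
        intro!: integral_add integral_T_bound[OF assms M(2), THEN order_trans])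
  then show ?thesis
    by (simp add: orbit_int_def bounded_linear_Blinfun_apply)
qed

lemma norm_orbit_int_le:
  assumes "a \<le> b" "b \<le> t" "M \<ge> 0" "\<And>s. 0 \<le> s \<Longrightarrow> s \<le> t - a \<Longrightarrow> norm (T s) \<le> M"
  shows "norm (orbit_int t a b) \<le> M * (b - a)"
  using assms by (intro norm_blinfun_bound) (auto simp: orbit_int_apply integral_T_bound)

text \<open>Applied below to scalars, to \<open>T\<close> itself and to the resolvent.\<close>
lemma orbit_int_commute:
  assumes "a \<le> b" "b \<le> t" "bounded_linear L" "\<And>s x. s \<ge> 0 \<Longrightarrow> T s (L x) = L (T s x)"
  shows "orbit_int t a b (L x) = L (orbit_int t a b x)"
proof -
  have "integral {a..b} (\<lambda>\<tau>. T (t - \<tau>) (L x)) = integral {a..b} (L \<circ> (\<lambda>\<tau>. T (t - \<tau>) x))"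
    using assms by (intro integral_cong) auto
  also have "\<dots> = L (integral {a..b} (\<lambda>\<tau>. T (t - \<tau>) x))"
    by (intro integral_linear integrable_T_reversed assms)
  finally show ?thesis
    using assms by (simp add: orbit_int_apply)
qed

lemma orbit_int_smul: "a \<le> b \<Longrightarrow> b \<le> t \<Longrightarrow> orbit_int t a b (smul k x) = smul k (orbit_int t a b x)"
  by (rule orbit_int_commute) (auto simp: bounded_linear_smul T_smul)

lemma orbit_int_T: "a \<le> b \<Longrightarrow> b \<le> t \<Longrightarrow> s \<ge> 0 \<Longrightarrow> orbit_int t a b (T s x) = T s (orbit_int t a b x)"
  by (rule orbit_int_commute) (auto simp: T_commute blinfun.bounded_linear_right)

lemma orbit_int_A0: "w \<in> A0_dom T \<Longrightarrow> a \<le> b \<Longrightarrow> b \<le> t \<Longrightarrow> orbit_int t a b (A0 T w) = T (t - a) w - T (t - b) w"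
  by (simp add: orbit_int_apply integral_unique[OF integral_orbit_generator])

lemma orbit_int_average: "((\<lambda>h. orbit_int h 0 h x /\<^sub>R h) \<longlongrightarrow> x) (at_right 0)"
proof -
  have "((\<lambda>h. integral {0..h} (\<lambda>\<tau>. T (h - \<tau>) x) /\<^sub>R h) \<longlongrightarrow> T 0 x) (at_right 0)"
    by (rule average_at_right_0[OF continuous_T])
  then have "((\<lambda>h. integral {0..h} (\<lambda>\<tau>. T (h - \<tau>) x) /\<^sub>R h) \<longlongrightarrow> x) (at_right 0)"
    by simp
  then show ?thesis
    by (rule Lim_transform_eventually)
      (auto simp: eventually_at_right_field orbit_int_apply intro!: exI[of _ 1])
qed

lemma A0_domI:
  assumes "((\<lambda>h. (T h w - w) /\<^sub>R h) \<longlongrightarrow> y) (at_right 0)"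
  shows "w \<in> A0_dom T" "A0 T w = y"
  using assms by (auto intro: generator_domI generator_eqI)

text \<open>Difference quotients pass through any bounded operator that commutes with the semigroup.\<close>
lemma A0_image:
  assumes w: "w \<in> A0_dom T" and L: "bounded_linear L" "\<And>s x. s \<ge> 0 \<Longrightarrow> T s (L x) = L (T s x)"
  shows "L w \<in> A0_dom T" "A0 T (L w) = L (A0 T w)"
proof -
  interpret L: bounded_linear L by fact
  have "((\<lambda>h. L ((T h w - w) /\<^sub>R h)) \<longlongrightarrow> L (A0 T w)) (at_right 0)"
    by (intro L.tendsto A0_tendsto w)
  then have "((\<lambda>h. (T h (L w) - L w) /\<^sub>R h) \<longlongrightarrow> L (A0 T w)) (at_right 0)"
    by (rule Lim_transform_eventually)
      (auto simp: eventually_at_right_field L.scaleR L.diff L(2) intro!: exI[of _ 1])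
  then show "L w \<in> A0_dom T" "A0 T (L w) = L (A0 T w)"
    by (rule A0_domI)+
qed

lemma A0_add:
  assumes "v \<in> A0_dom T" "w \<in> A0_dom T"
  shows "v + w \<in> A0_dom T" "A0 T (v + w) = A0 T v + A0 T w"
proof -
  have "((\<lambda>h. (T h v - v) /\<^sub>R h + (T h w - w) /\<^sub>R h) \<longlongrightarrow> A0 T v + A0 T w) (at_right 0)"
    by (intro tendsto_add A0_tendsto assms)
  then have "((\<lambda>h. (T h (v + w) - (v + w)) /\<^sub>R h) \<longlongrightarrow> A0 T v + A0 T w) (at_right 0)"
    by (simp add: blinfun.add_right algebra_simps)
  then show "v + w \<in> A0_dom T" "A0 T (v + w) = A0 T v + A0 T w"
    by (rule A0_domI)+
qed

lemma A0_smul: "w \<in> A0_dom T \<Longrightarrow> smul k w \<in> A0_dom T \<and> A0 T (smul k w) = smul k (A0 T w)"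
  by (blast intro: A0_image bounded_linear_smul T_smul)

end

section \<open>The sun dual and its dual\<close>

lemma dual_scale_apply [simp]: "dual_scale k \<phi> x = k * \<phi> x"
  by (simp add: dual_scale_def)

lemma adj_apply [simp]: "adj T t \<phi> x = \<phi> (T t x)"
  by (simp add: adj_def)

lemma norm_dual_scale_le: "norm (dual_scale k \<phi>) \<le> norm k * norm \<phi>"
  by (rule norm_blinfun_bound)
    (auto simp: norm_mult mult.assoc intro!: mult_left_mono norm_blinfun)

context scaled_semigroup
begin

abbreviation "sun \<equiv> sun_dual smul T"
abbreviation "star \<equiv> sun_star smul T"

lemma dual_spaceD: "\<phi> \<in> dual_space smul \<Longrightarrow> \<phi> (smul k x) = k * \<phi> x"
  by (simp add: dual_space_def)

lemma sun_dualD: "\<phi> \<in> sun \<Longrightarrow> \<phi> \<in> dual_space smul"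
  by (simp add: sun_dual_def)

lemma sun_tendsto: "\<phi> \<in> sun \<Longrightarrow> ((\<lambda>t. norm (adj T t \<phi> - \<phi>)) \<longlongrightarrow> 0) (at_right 0)"
  by (simp add: sun_dual_def)

lemma sunI:
  assumes "\<phi> \<in> dual_space smul" "(g \<longlongrightarrow> 0) (at_right 0)"
    "\<And>h. 0 < h \<Longrightarrow> h \<le> 1 \<Longrightarrow> norm (adj T h \<phi> - \<phi>) \<le> g h"
  shows "\<phi> \<in> sun"
proof -
  have "\<forall>\<^sub>F h in at_right 0. norm (norm (adj T h \<phi> - \<phi>)) \<le> g h"
    unfolding eventually_at_right_field using assms(3) by (intro exI[of _ 1]) auto
  from Lim_null_comparison[OF this assms(2)] assms(1) show ?thesis
    by (simp add: sun_dual_def)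
qed

lemma subspace_sun: "subspace sun"
proof (rule subspaceI)
  show "0 \<in> sun"
    by (simp add: sun_dual_def dual_space_def adj_def)
  fix \<phi> \<psi> assume in_sun: "\<phi> \<in> sun" "\<psi> \<in> sun"
  show "\<phi> + \<psi> \<in> sun"
  proof (rule sunI)
    show "\<phi> + \<psi> \<in> dual_space smul"
      using in_sun[THEN sun_dualD] by (auto simp: dual_space_def blinfun.add_left distrib_left)
    show "((\<lambda>t. norm (adj T t \<phi> - \<phi>) + norm (adj T t \<psi> - \<psi>)) \<longlongrightarrow> 0) (at_right 0)"
      by (rule tendsto_add_zero) (intro sun_tendsto in_sun)+
    have "adj T h (\<phi> + \<psi>) - (\<phi> + \<psi>) = (adj T h \<phi> - \<phi>) + (adj T h \<psi> - \<psi>)" for h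
      by (rule blinfun_eqI) (simp add: blinfun.add_left blinfun.diff_left)
    then show "norm (adj T h (\<phi> + \<psi>) - (\<phi> + \<psi>)) \<le> norm (adj T h \<phi> - \<phi>) + norm (adj T h \<psi> - \<psi>)" for h
      by (simp only: norm_triangle_ineq)
  qed
qed (rule sun_dual_scaleR)

lemma dual_scale_sun:
  assumes \<phi>: "\<phi> \<in> sun"
  shows "dual_scale k \<phi> \<in> sun"
proof (rule sunI)
  show "dual_scale k \<phi> \<in> dual_space smul"
    using sun_dualD[OF \<phi>] by (auto simp: dual_space_def)
  show "((\<lambda>t. norm k * norm (adj T t \<phi> - \<phi>)) \<longlongrightarrow> 0) (at_right 0)"
    by (intro tendsto_mult_right_zero sun_tendsto \<phi>)
  have "adj T h (dual_scale k \<phi>) - dual_scale k \<phi> = dual_scale k (adj T h \<phi> - \<phi>)" for h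
    by (rule blinfun_eqI) (simp add: blinfun.diff_left right_diff_distrib)
  then show "norm (adj T h (dual_scale k \<phi>) - dual_scale k \<phi>) \<le> norm k * norm (adj T h \<phi> - \<phi>)" for h
    by (simp only: norm_dual_scale_le)
qed

text \<open>An operator that commutes with the semigroup leaves the modulus of continuity of \<open>\<phi>\<close> intact, up to its norm.\<close>
lemma sun_compose:
  fixes L :: "'a \<Rightarrow>\<^sub>L 'a"
  assumes \<phi>: "\<phi> \<in> sun"
    and L: "\<And>k x. L (smul k x) = smul k (L x)" "\<And>s x. s \<ge> 0 \<Longrightarrow> T s (L x) = L (T s x)"
  shows "\<phi> o\<^sub>L L \<in> sun"
proof (rule sunI)
  show "\<phi> o\<^sub>L L \<in> dual_space smul"
    using sun_dualD[OF \<phi>] by (auto simp: dual_space_def L)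
  show "((\<lambda>t. norm (adj T t \<phi> - \<phi>) * norm L) \<longlongrightarrow> 0) (at_right 0)"
    by (intro tendsto_mult_left_zero sun_tendsto \<phi>)
  fix h :: real assume "0 < h"
  then have "adj T h (\<phi> o\<^sub>L L) - (\<phi> o\<^sub>L L) = (adj T h \<phi> - \<phi>) o\<^sub>L L"
    by (intro blinfun_eqI) (simp add: blinfun.diff_left L)
  then show "norm (adj T h (\<phi> o\<^sub>L L) - (\<phi> o\<^sub>L L)) \<le> norm (adj T h \<phi> - \<phi>) * norm L"
    by (simp only: norm_blinfun_compose)
qed

lemma adj_sun: "\<phi> \<in> sun \<Longrightarrow> t \<ge> 0 \<Longrightarrow> adj T t \<phi> \<in> sun"
  unfolding adj_def by (rule sun_compose) (auto simp: T_smul T_commute)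

lemma sun_orbit_int: "\<phi> \<in> sun \<Longrightarrow> a \<le> b \<Longrightarrow> b \<le> t \<Longrightarrow> \<phi> o\<^sub>L orbit_int t a b \<in> sun"
  by (rule sun_compose) (auto simp: orbit_int_smul orbit_int_T)

lemma norm_adj_le:
  assumes "norm (T t) \<le> M"
  shows "norm (adj T t \<phi>) \<le> M * norm \<phi>"
  using norm_blinfun_compose[of \<phi> "T t"] mult_left_mono[OF assms norm_ge_zero[of \<phi>]]
  by (simp add: adj_def mult.commute)

lemma continuous_adj:
  assumes \<phi>: "\<phi> \<in> sun"
  shows "continuous_on {0..c} (\<lambda>t. adj T t \<phi>)"
proof -
  obtain M where M: "M > 0" "\<And>t. 0 \<le> t \<Longrightarrow> t \<le> c \<Longrightarrow> norm (T t) \<le> M"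
    using T_locally_bounded by blast
  show ?thesis
  proof (rule continuous_on_right_modulus)
    show "((\<lambda>h. M * norm (adj T h \<phi> - \<phi>)) \<longlongrightarrow> 0) (at_right 0)"
      by (intro tendsto_mult_right_zero sun_tendsto \<phi>)
    fix r s :: real
    assume rs: "0 \<le> r" "r < s" "s \<le> c"
    have "adj T s \<phi> - adj T r \<phi> = adj T r (adj T (s - r) \<phi> - \<phi>)"
      using rs by (intro blinfun_eqI) (simp add: blinfun.diff_left T_T)
    then show "norm (adj T s \<phi> - adj T r \<phi>) \<le> M * norm (adj T (s - r) \<phi> - \<phi>)"
      using rs M(2)[of r] by (simp add: norm_adj_le)
  qed
qed

lemma continuous_adj_reversed:
  "\<phi> \<in> sun \<Longrightarrow> b \<le> t \<Longrightarrow> continuous_on {a..b} (\<lambda>\<tau>. adj T (t - \<tau>) \<phi>)"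
  by (rule continuous_on_compose2[OF continuous_adj[of _ "t - a"]]) (auto intro!: continuous_intros)

lemma integral_adj:
  assumes \<phi>: "\<phi> \<in> sun" and ab: "a \<le> b" "b \<le> t"
  shows "integral {a..b} (\<lambda>\<tau>. adj T (t - \<tau>) \<phi>) = \<phi> o\<^sub>L orbit_int t a b"
proof (rule blinfun_eqI)
  fix x
  have "integral {a..b} ((\<lambda>\<psi>. blinfun_apply \<psi> x) \<circ> (\<lambda>\<tau>. adj T (t - \<tau>) \<phi>))
      = blinfun_apply (integral {a..b} (\<lambda>\<tau>. adj T (t - \<tau>) \<phi>)) x"
    by (intro integral_linear integrable_continuous_real continuous_adj_reversed \<phi> ab
        blinfun.bounded_linear_left)
  moreover have "integral {a..b} (blinfun_apply \<phi> \<circ> (\<lambda>\<tau>. T (t - \<tau>) x)) = \<phi> (orbit_int t a b x)"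
    using ab by (simp add: orbit_int_apply integral_linear integrable_T_reversed blinfun.bounded_linear_right)
  ultimately show "blinfun_apply (integral {a..b} (\<lambda>\<tau>. adj T (t - \<tau>) \<phi>)) x = (\<phi> o\<^sub>L orbit_int t a b) x"
    by (simp add: o_def)
qed

lemma sun_average:
  assumes \<phi>: "\<phi> \<in> sun"
  shows "((\<lambda>h. (\<phi> o\<^sub>L orbit_int h 0 h) /\<^sub>R h) \<longlongrightarrow> \<phi>) (at_right 0)"
proof -
  have "adj T 0 \<phi> = \<phi>"
    by (rule blinfun_eqI) simp
  then have "((\<lambda>h. integral {0..h} (\<lambda>\<tau>. adj T (h - \<tau>) \<phi>) /\<^sub>R h) \<longlongrightarrow> \<phi>) (at_right 0)"
    using average_at_right_0[OF continuous_adj[OF \<phi>]] by simp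
  then show ?thesis
    by (rule Lim_transform_eventually)
      (auto simp: eventually_at_right_field integral_adj \<phi> intro!: exI[of _ 1])
qed

lemma star_add: "F \<in> star \<Longrightarrow> \<phi> \<in> sun \<Longrightarrow> \<psi> \<in> sun \<Longrightarrow> F (\<phi> + \<psi>) = F \<phi> + F \<psi>"
  and star_scale: "F \<in> star \<Longrightarrow> \<phi> \<in> sun \<Longrightarrow> F (dual_scale k \<phi>) = k * F \<phi>"
  and star_outside: "F \<in> star \<Longrightarrow> \<phi> \<notin> sun \<Longrightarrow> F \<phi> = 0"
  by (simp_all add: sun_star_def)

lemma star_scaleR:
  assumes "F \<in> star" "\<phi> \<in> sun"
  shows "F (r *\<^sub>R \<phi>) = r *\<^sub>R F \<phi>"
proof -
  have "r *\<^sub>R \<phi> = dual_scale (of_real r) \<phi>"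
    by (rule blinfun_eqI) (simp add: blinfun.scaleR_left scaleR_conv_of_real)
  with assms show ?thesis
    by (simp add: star_scale scaleR_conv_of_real)
qed

lemma star_diff:
  assumes "F \<in> star" "\<phi> \<in> sun" "\<psi> \<in> sun"
  shows "F (\<phi> - \<psi>) = F \<phi> - F \<psi>"
  using star_add[OF assms(1,2), of "- \<psi>"] star_scaleR[OF assms(1,3), of "- 1"]
    subspace_neg[OF subspace_sun assms(3)] by simp

lemma star_bound:
  assumes "F \<in> star"
  obtains C where "C > 0" "\<And>\<phi>. \<phi> \<in> sun \<Longrightarrow> norm (F \<phi>) \<le> C * norm \<phi>"
proof -
  obtain C where C: "\<And>\<phi>. \<phi> \<in> sun \<Longrightarrow> norm (F \<phi>) \<le> C * norm \<phi>"
    using assms unfolding sun_star_def by blast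
  have "norm (F \<phi>) \<le> (\<bar>C\<bar> + 1) * norm \<phi>" if "\<phi> \<in> sun" for \<phi>
    using C[OF that] mult_right_mono[of C "\<bar>C\<bar> + 1" "norm \<phi>"] by force
  then show thesis
    by (intro that[of "\<bar>C\<bar> + 1"]) auto
qed

lemma star_combine:
  assumes F: "F \<in> star" and H: "H \<in> star"
  shows "(\<lambda>\<phi>. k * F \<phi> + m * H \<phi>) \<in> star"
proof -
  obtain C where C: "\<And>\<phi>. \<phi> \<in> sun \<Longrightarrow> norm (F \<phi>) \<le> C * norm \<phi>"
    using star_bound[OF F] by blast
  obtain D where D: "\<And>\<phi>. \<phi> \<in> sun \<Longrightarrow> norm (H \<phi>) \<le> D * norm \<phi>"
    using star_bound[OF H] by blast
  have "norm (k * F \<phi> + m * H \<phi>) \<le> (norm k * C + norm m * D) * norm \<phi>" if "\<phi> \<in> sun" for \<phi>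
  proof -
    have "norm (k * F \<phi> + m * H \<phi>) \<le> norm k * norm (F \<phi>) + norm m * norm (H \<phi>)"
      by (metis norm_mult norm_triangle_ineq)
    also have "\<dots> \<le> norm k * (C * norm \<phi>) + norm m * (D * norm \<phi>)"
      using that by (intro add_mono mult_left_mono C D) auto
    finally show ?thesis by (simp add: algebra_simps)
  qed
  then have "\<exists>E. \<forall>\<phi>\<in>sun. norm (k * F \<phi> + m * H \<phi>) \<le> E * norm \<phi>"
    by blast
  then show ?thesis
    using F H by (simp add: sun_star_def algebra_simps)
qed

lemma star_tendsto:
  assumes F: "F \<in> star" and f: "(f \<longlongrightarrow> \<phi>) A" and sun: "\<phi> \<in> sun" "\<forall>\<^sub>F h in A. f h \<in> sun"
  shows "((\<lambda>h. F (f h)) \<longlongrightarrow> F \<phi>) A"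
proof -
  obtain C where C: "\<And>\<phi>. \<phi> \<in> sun \<Longrightarrow> norm (F \<phi>) \<le> C * norm \<phi>"
    using star_bound[OF F] by blast
  have "((\<lambda>h. C * norm (f h - \<phi>)) \<longlongrightarrow> C * norm (\<phi> - \<phi>)) A"
    by (intro tendsto_intros f)
  then have "((\<lambda>h. C * norm (f h - \<phi>)) \<longlongrightarrow> 0) A" by simp
  moreover have "\<forall>\<^sub>F h in A. norm (F (f h) - F \<phi>) \<le> C * norm (f h - \<phi>)"
    using sun(2)
  proof eventually_elim
    case (elim h)
    then show ?case
      using C[of "f h - \<phi>"] subspace_diff[OF subspace_sun elim sun(1)] star_diff[OF F elim sun(1)]
      by simp
  qed
  ultimately have "((\<lambda>h. F (f h) - F \<phi>) \<longlongrightarrow> 0) A"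
    by (rule Lim_null_comparison[rotated])
  then show ?thesis by (rule LIM_zero_cancel)
qed

text \<open>
  The weak-star integral of the orbit of a constant \<open>F\<close> is \<open>F\<close> applied to a norm integral in the sun
  dual, which is composition with \<open>orbit_int\<close>.
\<close>
lemma integral_star_orbit:
  assumes F: "F \<in> star" and \<phi>: "\<phi> \<in> sun" and ab: "a \<le> b" "b \<le> t"
  shows "((\<lambda>\<tau>. F (adj T (t - \<tau>) \<phi>)) has_integral F (\<phi> o\<^sub>L orbit_int t a b)) {a..b}"
proof -
  obtain C where "\<And>\<phi>. \<phi> \<in> sun \<Longrightarrow> norm (F \<phi>) \<le> C * norm \<phi>"
    using star_bound[OF F] by blast
  then have "((\<lambda>\<tau>. F (adj T (t - \<tau>) \<phi>)) has_integral F (integral {a..b} (\<lambda>\<tau>. adj T (t - \<tau>) \<phi>))) {a..b}"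
    using ab by (intro integral_linear_on_subspace[OF _ _ subspace_sun])
      (auto intro: continuous_adj_reversed adj_sun sun_orbit_int star_add star_scaleR F \<phi> simp: integral_adj \<phi>)
  then show ?thesis by (simp add: integral_adj \<phi> ab)
qed

lemma star_norm_bound:
  assumes F: "F \<in> star" and \<phi>: "\<phi> \<in> sun"
  shows "norm (F \<phi>) \<le> sun_star_norm smul T F * norm \<phi>"
proof (cases "\<phi> = 0")
  case True
  then show ?thesis
    using star_scaleR[OF F \<phi>, of 0] by simp
next
  case False
  obtain C where C: "C > 0" "\<And>\<phi>. \<phi> \<in> sun \<Longrightarrow> norm (F \<phi>) \<le> C * norm \<phi>"
    using star_bound[OF F] by blast
  define \<psi> where "\<psi> = \<phi> /\<^sub>R norm \<phi>"
  have \<psi>: "\<psi> \<in> sun" "norm \<psi> \<le> 1"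
    using False sun_dual_scaleR[OF \<phi>] by (auto simp: \<psi>_def)
  have "norm (F \<psi>) \<le> sun_star_norm smul T F"
    unfolding sun_star_norm_def
  proof (rule cSup_upper)
    show "norm (F \<psi>) \<in> {norm (F \<phi>) |\<phi>. \<phi> \<in> sun \<and> norm \<phi> \<le> 1}"
      using \<psi> by blast
    have "norm (F \<eta>) \<le> C" if "\<eta> \<in> sun" "norm \<eta> \<le> 1" for \<eta>
      using C(2)[OF that(1)] mult_left_mono[OF that(2) less_imp_le[OF C(1)]] by linarith
    then show "bdd_above {norm (F \<phi>) |\<phi>. \<phi> \<in> sun \<and> norm \<phi> \<le> 1}"
      by (intro bdd_aboveI[of _ C]) auto
  qed
  moreover have "F \<psi> = F \<phi> /\<^sub>R norm \<phi>"
    unfolding \<psi>_def by (rule star_scaleR[OF F \<phi>])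
  ultimately show ?thesis
    using False by (simp add: field_simps)
qed

text \<open>The form in which the topology on the dual of the sun dual is used: the distance is an operator norm.\<close>
lemma star_dist_bound:
  assumes F: "F \<in> star" and H: "H \<in> star" and \<phi>: "\<phi> \<in> sun"
  shows "norm (F \<phi> - H \<phi>) \<le> sun_star_dist smul T F H * norm \<phi>"
  using star_norm_bound[OF star_combine[OF F H, of 1 "- 1"] \<phi>] F H
  by (simp add: sun_star_dist_def)

text \<open>
  Joint continuity: move \<open>f\<close> in norm while the orbit of \<open>\<phi>\<close> stays bounded, then move the orbit of \<open>\<phi>\<close>
  under the fixed functional \<open>f \<tau>\<close>.
\<close>
lemma continuous_star_valued_orbit:
  assumes f: "\<And>\<tau>. \<tau> \<in> {s..t} \<Longrightarrow> f \<tau> \<in> star"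
    "\<And>\<tau>. \<tau> \<in> {s..t} \<Longrightarrow> ((\<lambda>\<sigma>. sun_star_dist smul T (f \<tau>) (f \<sigma>)) \<longlongrightarrow> 0) (at \<tau> within {s..t})"
    and \<phi>: "\<phi> \<in> sun"
  shows "continuous_on {s..t} (\<lambda>\<tau>. f \<tau> (adj T (t - \<tau>) \<phi>))"
  unfolding continuous_on_def
proof
  fix \<tau> assume \<tau>: "\<tau> \<in> {s..t}"
  obtain M where M: "M > 0" "\<And>r. 0 \<le> r \<Longrightarrow> r \<le> t - s \<Longrightarrow> norm (T r) \<le> M"
    using T_locally_bounded by blast
  let ?\<psi> = "\<lambda>\<sigma>. adj T (t - \<sigma>) \<phi>" and ?d = "\<lambda>\<sigma>. sun_star_dist smul T (f \<tau>) (f \<sigma>)"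
  have "(?\<psi> \<longlongrightarrow> ?\<psi> \<tau>) (at \<tau> within {s..t})"
    using continuous_adj_reversed[OF \<phi>, of t t s] \<tau> by (simp add: continuous_on_def)
  then have 1: "((\<lambda>\<sigma>. f \<tau> (?\<psi> \<sigma>)) \<longlongrightarrow> f \<tau> (?\<psi> \<tau>)) (at \<tau> within {s..t})"
    using \<tau> adj_sun[OF \<phi>] by (intro star_tendsto f(1)) (simp_all add: eventually_at_filter)
  have "((\<lambda>\<sigma>. f \<tau> (?\<psi> \<sigma>) - f \<sigma> (?\<psi> \<sigma>)) \<longlongrightarrow> 0) (at \<tau> within {s..t})"
  proof (rule Lim_null_comparison)
    show "((\<lambda>\<sigma>. ?d \<sigma> * (M * norm \<phi>)) \<longlongrightarrow> 0) (at \<tau> within {s..t})"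
      by (intro tendsto_mult_left_zero f \<tau>)
    have "norm (f \<tau> (?\<psi> \<sigma>) - f \<sigma> (?\<psi> \<sigma>)) \<le> ?d \<sigma> * (M * norm \<phi>)" if "\<sigma> \<in> {s..t}" for \<sigma>
    proof -
      have "norm (f \<tau> (?\<psi> \<sigma>) - f \<sigma> (?\<psi> \<sigma>)) \<le> ?d \<sigma> * norm (?\<psi> \<sigma>)"
        using that \<tau> by (intro star_dist_bound f(1) adj_sun \<phi>) auto
      also have "\<dots> \<le> ?d \<sigma> * (M * norm \<phi>)"
        using that M Metric_space.nonneg[OF Metric_space_sun_star]
        by (intro mult_left_mono norm_adj_le) auto
      finally show ?thesis .
    qed
    then show "\<forall>\<^sub>F \<sigma> in at \<tau> within {s..t}. norm (f \<tau> (?\<psi> \<sigma>) - f \<sigma> (?\<psi> \<sigma>)) \<le> ?d \<sigma> * (M * norm \<phi>)"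
      by (simp add: eventually_at_filter)
  qed
  from tendsto_diff[OF 1 this] show "((\<lambda>\<sigma>. f \<sigma> (?\<psi> \<sigma>)) \<longlongrightarrow> f \<tau> (?\<psi> \<tau>)) (at \<tau> within {s..t})"
    by simp
qed

end

section \<open>The resolvent and its adjoint\<close>

locale semigroup_resolvent = scaled_semigroup smul T
  for smul :: "'k::{real_normed_field,euclidean_space} \<Rightarrow> 'a::banach \<Rightarrow> 'a" and T +
  fixes l :: 'k
  assumes l: "l \<in> resolvent_set smul (A0_dom T) (A0 T)"
begin

definition R :: "'a \<Rightarrow>\<^sub>L 'a" where
  "R = Blinfun (inv_into (A0_dom T) (\<lambda>x. smul l x - A0 T x))"

lemma R_in_dom: "R x \<in> A0_dom T" (is ?A)
  and resolvent_R: "smul l (R x) - A0 T (R x) = x" (is ?B)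
  and R_resolvent: "w \<in> A0_dom T \<Longrightarrow> R (smul l w - A0 T w) = w" (is "_ \<Longrightarrow> ?C")
proof -
  define f where "f w = smul l w - A0 T w" for w
  define g where "g = inv_into (A0_dom T) f"
  have bij: "bij_betw f (A0_dom T) UNIV"
    using l by (simp add: resolvent_set_def f_def[abs_def])
  obtain C where C: "\<And>w. w \<in> A0_dom T \<Longrightarrow> norm w \<le> C * norm (f w)"
    using l by (auto simp: resolvent_set_def f_def)
  have g_dom: "g x \<in> A0_dom T" and fg: "f (g x) = x" for x
    using bij by (auto simp: g_def bij_betw_def intro: inv_into_into f_inv_into_f)
  have gf: "g (f w) = w" if "w \<in> A0_dom T" for w
    using bij that by (simp add: g_def bij_betw_def)
  have f_add: "f (v + w) = f v + f w" if "v \<in> A0_dom T" "w \<in> A0_dom T" for v w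
    using that by (simp add: f_def A0_add smul.scale_right_distrib)
  have f_scaleR: "f (r *\<^sub>R w) = r *\<^sub>R f w" if "w \<in> A0_dom T" for r w
    using A0_smul[OF that, of "of_real r"] linear_scale[OF bounded_linear.linear[OF bounded_linear_smul]]
    by (simp add: f_def smul_of_real scaleR_diff_right)
  have "bounded_linear g"
  proof (rule bounded_linear_intro)
    show "g (x + y) = g x + g y" for x y
      using gf[of "g x + g y"] f_add[of "g x" "g y"] A0_add(1) g_dom by (simp add: fg)
    show "g (r *\<^sub>R x) = r *\<^sub>R g x" for r x
      using gf[of "r *\<^sub>R g x"] f_scaleR[of "g x"] A0_smul[of "g x" "of_real r"] g_dom
      by (simp add: fg smul_of_real)
    show "norm (g x) \<le> norm x * C" for x
      using C[OF g_dom[of x]] by (simp add: fg mult.commute)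
  qed
  then have "blinfun_apply R = g"
    by (simp add: R_def bounded_linear_Blinfun_apply g_def f_def[abs_def])
  with g_dom fg gf show ?A ?B "w \<in> A0_dom T \<Longrightarrow> ?C"
    by (auto simp: f_def)
qed

lemma A0_R: "A0 T (R x) = smul l (R x) - x"
  using resolvent_R[of x] by (simp add: algebra_simps)

text \<open>Both sides solve the resolvent equation with right-hand side \<open>L x\<close>.\<close>
lemma R_commute:
  assumes "\<And>x. L (smul l x) = smul l (L x)" "bounded_linear L"
    "\<And>s x. s \<ge> 0 \<Longrightarrow> T s (L x) = L (T s x)"
  shows "R (L x) = L (R x)"
proof -
  interpret L: bounded_linear L by fact
  have "smul l (L (R x)) - A0 T (L (R x)) = L x"
    using assms A0_image[OF R_in_dom] by (simp add: A0_R L.diff)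
  with R_resolvent[of "L (R x)"] A0_image(1)[OF R_in_dom assms(2,3)] show ?thesis by simp
qed

lemma R_smul: "R (smul k x) = smul k (R x)"
  by (rule R_commute) (simp_all add: bounded_linear_smul T_smul mult.commute)

lemma R_T: "t \<ge> 0 \<Longrightarrow> R (T t x) = T t (R x)"
  by (rule R_commute) (simp_all add: blinfun.bounded_linear_right T_smul T_commute)

lemma R_orbit_int: "a \<le> b \<Longrightarrow> b \<le> t \<Longrightarrow> R (orbit_int t a b x) = orbit_int t a b (R x)"
  by (rule orbit_int_commute[symmetric]) (simp_all add: blinfun.bounded_linear_right R_T)

text \<open>
  The key estimate: \<open>T h (R x) - R x\<close> is the integral of the orbit of \<open>A0 T (R x)\<close>, and \<open>A0 T \<circ> R\<close> is
  bounded.  Thus the semigroup is continuous in operator norm once it is preceded by \<open>R\<close>.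
\<close>
lemma T_R_lipschitz:
  obtains K where "K \<ge> 0" "\<And>h. 0 \<le> h \<Longrightarrow> h \<le> 1 \<Longrightarrow> norm ((T h o\<^sub>L R) - R) \<le> K * h"
proof -
  obtain M where M: "M > 0" "\<And>t. 0 \<le> t \<Longrightarrow> t \<le> 1 \<Longrightarrow> norm (T t) \<le> M"
    using T_locally_bounded by blast
  define K where "K = M * (norm l * norm R + 1)"
  have K: "K \<ge> 0" using M(1) by (simp add: K_def)
  moreover have "norm ((T h o\<^sub>L R) - R) \<le> K * h" if h: "0 \<le> h" "h \<le> 1" for h
  proof (rule norm_blinfun_bound)
    fix x
    have "norm (A0 T (R x)) \<le> norm l * norm (R x) + norm x"
      unfolding A0_R by (rule norm_triangle_le_diff) (simp add: norm_smul)
    also have "\<dots> \<le> norm l * (norm R * norm x) + norm x"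
      by (intro add_mono mult_left_mono norm_blinfun) auto
    finally have 1: "norm (A0 T (R x)) \<le> (norm l * norm R + 1) * norm x"
      by (simp add: algebra_simps)
    have "((T h o\<^sub>L R) - R) x = orbit_int h 0 h (A0 T (R x))"
      using h by (simp add: orbit_int_A0 R_in_dom blinfun.diff_left)
    also have "norm \<dots> \<le> norm (orbit_int h 0 h) * norm (A0 T (R x))"
      by (rule norm_blinfun)
    also have "\<dots> \<le> M * (h - 0) * ((norm l * norm R + 1) * norm x)"
      using h M by (intro mult_mono 1 norm_orbit_int_le) auto
    finally show "norm (((T h o\<^sub>L R) - R) x) \<le> K * h * norm x"
      by (simp add: K_def mult_ac)
  qed (use K h in simp)
  ultimately show thesis by (rule that)
qed

text \<open>Composition with \<open>R\<close> regularises: by \<open>T_R_lipschitz\<close> it maps every functional into the sun dual.\<close>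
lemma dual_R_sun:
  assumes \<phi>: "\<phi> \<in> dual_space smul"
  shows "\<phi> o\<^sub>L R \<in> sun"
proof -
  obtain K where K: "\<And>h. 0 \<le> h \<Longrightarrow> h \<le> 1 \<Longrightarrow> norm ((T h o\<^sub>L R) - R) \<le> K * h"
    using T_R_lipschitz by blast
  show ?thesis
  proof (rule sunI)
    show "\<phi> o\<^sub>L R \<in> dual_space smul"
      using \<phi> by (simp add: dual_space_def R_smul)
    have "((\<lambda>h. norm \<phi> * (K * h)) \<longlongrightarrow> norm \<phi> * (K * 0)) (at_right 0)"
      by (intro tendsto_intros)
    then show "((\<lambda>h. norm \<phi> * (K * h)) \<longlongrightarrow> 0) (at_right 0)" by simp
    fix h :: real assume h: "0 < h" "h \<le> 1"
    have "adj T h (\<phi> o\<^sub>L R) - (\<phi> o\<^sub>L R) = \<phi> o\<^sub>L ((T h o\<^sub>L R) - R)"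
      using h by (intro blinfun_eqI) (simp add: blinfun.diff_left blinfun.diff_right R_T)
    also have "norm \<dots> \<le> norm \<phi> * norm ((T h o\<^sub>L R) - R)"
      by (rule norm_blinfun_compose)
    also have "\<dots> \<le> norm \<phi> * (K * h)"
      using h by (intro mult_left_mono K) auto
    finally show "norm (adj T h (\<phi> o\<^sub>L R) - (\<phi> o\<^sub>L R)) \<le> norm \<phi> * (K * h)" .
  qed
qed

text \<open>
  \<open>(l - A)\<close> applied to the orbit integral of \<open>\<phi>\<close>, with the generator replaced by the boundary terms of
  the fundamental theorem of calculus.  Hence composition with \<open>R\<close> recovers that integral, and
  orbit integrals are in the range of the adjoint resolvent.
\<close>
definition orbit_int_preimage :: "real \<Rightarrow> real \<Rightarrow> real \<Rightarrow> ('a \<Rightarrow>\<^sub>L 'k) \<Rightarrow> 'a \<Rightarrow>\<^sub>L 'k" where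
  "orbit_int_preimage t a b \<phi> = dual_scale l (\<phi> o\<^sub>L orbit_int t a b) - (adj T (t - a) \<phi> - adj T (t - b) \<phi>)"

lemma orbit_int_preimage_R:
  assumes \<phi>: "\<phi> \<in> dual_space smul" and ab: "a \<le> b" "b \<le> t"
  shows "orbit_int_preimage t a b \<phi> o\<^sub>L R = \<phi> o\<^sub>L orbit_int t a b"
proof (rule blinfun_eqI)
  fix x
  have "orbit_int t a b x = smul l (orbit_int t a b (R x)) - (T (t - a) (R x) - T (t - b) (R x))"
    using orbit_int_A0[OF R_in_dom[of x] ab] by (simp add: A0_R blinfun.diff_right orbit_int_smul ab algebra_simps)
  then show "(orbit_int_preimage t a b \<phi> o\<^sub>L R) x = (\<phi> o\<^sub>L orbit_int t a b) x"
    by (simp add: orbit_int_preimage_def blinfun.diff_left blinfun.diff_right dual_spaceD[OF \<phi>])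
qed

lemma orbit_int_preimage_sun:
  assumes "\<phi> \<in> sun" "a \<le> b" "b \<le> t"
  shows "orbit_int_preimage t a b \<phi> \<in> sun"
  unfolding orbit_int_preimage_def using assms
  by (intro subspace_diff[OF subspace_sun] dual_scale_sun adj_sun sun_orbit_int) auto

lemma dual_orbit_int_sun:
  assumes \<phi>: "\<phi> \<in> dual_space smul" and ab: "a \<le> b" "b \<le> t"
  shows "\<phi> o\<^sub>L orbit_int t a b \<in> sun"
proof -
  have "orbit_int_preimage t a b \<phi> \<in> dual_space smul"
    using \<phi> ab
    by (simp add: orbit_int_preimage_def dual_space_def blinfun.diff_left blinfun.add_left orbit_int_smul T_smul algebra_simps)
  from dual_R_sun[OF this] show ?thesis by (simp add: orbit_int_preimage_R assms)
qed

section \<open>The embedded space is closed\<close>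

text \<open>
  Take a norm-attaining functional for \<open>x\<close> and average it over \<open>{0..h}\<close>.  The averages lie in the sun
  dual, their norms are at most the local bound of the semigroup, and their values at \<open>x\<close> converge
  back to the value of the original functional.
\<close>
lemma sun_norming:
  obtains M where "M > 0"
    "\<And>x B. (\<And>\<phi>. \<phi> \<in> sun \<Longrightarrow> norm (\<phi> x) \<le> B * norm \<phi>) \<Longrightarrow> B \<ge> 0 \<Longrightarrow> norm x \<le> M * B"
proof -
  obtain M where M: "M > 0" "\<And>t. 0 \<le> t \<Longrightarrow> t \<le> 1 \<Longrightarrow> norm (T t) \<le> M"
    using T_locally_bounded by blast
  have "norm x \<le> M * B" if x: "\<And>\<phi>. \<phi> \<in> sun \<Longrightarrow> norm (\<phi> x) \<le> B * norm \<phi>" and B: "B \<ge> 0" for x B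
  proof -
    obtain \<phi> where \<phi>: "\<phi> \<in> dual_space smul" "norm \<phi> \<le> 1" "norm x \<le> norm (\<phi> x)"
      using norming_functional[of x] by blast
    have "((\<lambda>h. norm (\<phi> (orbit_int h 0 h x /\<^sub>R h))) \<longlongrightarrow> norm (\<phi> x)) (at_right 0)"
      by (intro tendsto_norm bounded_linear.tendsto[OF blinfun.bounded_linear_right] orbit_int_average)
    moreover have "norm (\<phi> (orbit_int h 0 h x /\<^sub>R h)) \<le> M * B" if h: "0 < h" "h < 1" for h
    proof -
      define \<psi> where "\<psi> = (\<phi> o\<^sub>L orbit_int h 0 h) /\<^sub>R h"
      have "\<psi> \<in> sun"
        unfolding \<psi>_def using h by (intro sun_dual_scaleR dual_orbit_int_sun \<phi>) auto
      have "norm (\<phi> o\<^sub>L orbit_int h 0 h) \<le> norm \<phi> * norm (orbit_int h 0 h)"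
        by (rule norm_blinfun_compose)
      also have "\<dots> \<le> 1 * (M * (h - 0))"
        using h M by (intro mult_mono \<phi> norm_orbit_int_le) auto
      finally have "norm \<psi> \<le> M"
        using h by (simp add: \<psi>_def field_simps)
      have "norm (\<psi> x) \<le> B * norm \<psi>"
        by (rule x) fact
      also have "\<dots> \<le> B * M"
        using \<open>norm \<psi> \<le> M\<close> B by (rule mult_left_mono)
      finally show ?thesis
        by (simp add: \<psi>_def blinfun.scaleR_left blinfun.scaleR_right mult.commute)
    qed
    then have "\<forall>\<^sub>F h in at_right 0. norm (\<phi> (orbit_int h 0 h x /\<^sub>R h)) \<le> M * B"
      unfolding eventually_at_right_field by (intro exI[of _ 1]) auto
    ultimately have "norm (\<phi> x) \<le> M * B"
      by (rule tendsto_upperbound) simp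
    with \<phi>(3) show ?thesis by simp
  qed
  with M(1) show thesis by (rule that)
qed

text \<open>
  Approximations at \<open>1 / (n + 1)\<close> form a Cauchy sequence by \<open>sun_norming\<close>.  \<open>F\<close> is an arbitrary
  function, since a limit of embedded vectors is automatically linear and bounded.
\<close>
lemma embed_range_closed:
  fixes F :: "('a \<Rightarrow>\<^sub>L 'k) \<Rightarrow> 'k"
  assumes approx: "\<And>e. e > 0 \<Longrightarrow> \<exists>x. \<forall>\<phi>\<in>sun. norm (F \<phi> - \<phi> x) \<le> e * norm \<phi>"
  shows "\<exists>x. \<forall>\<phi>\<in>sun. F \<phi> = \<phi> x"
proof -
  obtain M where M: "M > 0"
    "\<And>x B. (\<And>\<phi>. \<phi> \<in> sun \<Longrightarrow> norm (\<phi> x) \<le> B * norm \<phi>) \<Longrightarrow> B \<ge> 0 \<Longrightarrow> norm x \<le> M * B"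
    using sun_norming by blast
  have "\<exists>x. \<forall>\<phi>\<in>sun. norm (F \<phi> - \<phi> x) \<le> inverse (real (Suc n)) * norm \<phi>" for n
    by (rule approx) simp
  then obtain X where X: "\<And>n \<phi>. \<phi> \<in> sun \<Longrightarrow> norm (F \<phi> - \<phi> (X n)) \<le> inverse (real (Suc n)) * norm \<phi>"
    by metis
  have dist: "norm (X m - X n) \<le> M * (inverse (real (Suc m)) + inverse (real (Suc n)))" for m n
  proof (rule M(2))
    fix \<phi> assume \<phi>: "\<phi> \<in> sun"
    have "\<phi> (X m - X n) = (F \<phi> - \<phi> (X n)) - (F \<phi> - \<phi> (X m))"
      by (simp add: blinfun.diff_right)
    also have "norm \<dots> \<le> inverse (real (Suc n)) * norm \<phi> + inverse (real (Suc m)) * norm \<phi>"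
      by (rule norm_triangle_le_diff) (intro add_mono X \<phi>)
    finally show "norm (\<phi> (X m - X n)) \<le> (inverse (real (Suc m)) + inverse (real (Suc n))) * norm \<phi>"
      by (simp only: distrib_right add.commute)
  qed simp
  have "Cauchy X"
  proof (rule metric_CauchyI)
    fix e :: real assume e: "e > 0"
    then obtain N where N: "inverse (real (Suc N)) < e / (2 * M)"
      using M(1) reals_Archimedean[of "e / (2 * M)"] by auto
    have "dist (X m) (X n) < e" if "m \<ge> N" "n \<ge> N" for m n
    proof -
      have "M * (inverse (real (Suc m)) + inverse (real (Suc n)))
          \<le> M * (inverse (real (Suc N)) + inverse (real (Suc N)))"
        using that M(1) by (intro mult_left_mono add_mono le_imp_inverse_le) auto
      also have "\<dots> < M * (e / (2 * M) + e / (2 * M))"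
        using N M(1) by (intro mult_strict_left_mono add_strict_mono)
      also have "\<dots> = e" using M(1) by (simp add: field_simps)
      finally show ?thesis
        using dist[of m n] by (simp add: dist_norm)
    qed
    then show "\<exists>N. \<forall>m\<ge>N. \<forall>n\<ge>N. dist (X m) (X n) < e" by blast
  qed
  then obtain x where x: "X \<longlonglongrightarrow> x"
    using Cauchy_convergent convergent_def by blast
  have "F \<phi> = \<phi> x" if \<phi>: "\<phi> \<in> sun" for \<phi>
  proof -
    have "(\<lambda>n. inverse (real (Suc n)) * norm \<phi>) \<longlonglongrightarrow> 0"
      by (intro tendsto_mult_left_zero LIMSEQ_inverse_real_of_nat)
    then have "(\<lambda>n. F \<phi> - \<phi> (X n)) \<longlonglongrightarrow> 0"
      by (rule Lim_null_comparison[rotated]) (simp add: X[OF \<phi>] del: of_nat_Suc)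
    moreover have "(\<lambda>n. F \<phi> - \<phi> (X n)) \<longlonglongrightarrow> F \<phi> - \<phi> x"
      by (intro tendsto_intros bounded_linear.tendsto[OF blinfun.bounded_linear_right] x)
    ultimately show ?thesis
      using LIMSEQ_unique by fastforce
  qed
  then show ?thesis by blast
qed

section \<open>The resolvent on the dual of the sun dual\<close>

text \<open>
  The difference quotients of \<open>\<phi> \<circ> R\<close> are exactly the averages of the orbit of \<open>dual_scale l (\<phi> \<circ> R) - \<phi>\<close>;
  they converge in norm because that functional belongs to the sun dual.
\<close>
lemma A0_sun_R:
  assumes \<phi>: "\<phi> \<in> sun"
  shows "\<phi> o\<^sub>L R \<in> A0_sun_dom smul T" "A0_sun T (\<phi> o\<^sub>L R) = dual_scale l (\<phi> o\<^sub>L R) - \<phi>"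
proof -
  let ?\<psi> = "dual_scale l (\<phi> o\<^sub>L R) - \<phi>"
  have R_sun: "\<phi> o\<^sub>L R \<in> sun"
    by (intro dual_R_sun sun_dualD \<phi>)
  then have \<psi>: "?\<psi> \<in> sun"
    by (intro subspace_diff[OF subspace_sun] dual_scale_sun \<phi>)
  have "adj T h (\<phi> o\<^sub>L R) - (\<phi> o\<^sub>L R) = ?\<psi> o\<^sub>L orbit_int h 0 h" if "h > 0" for h
  proof (rule blinfun_eqI)
    fix x
    have "T h (R x) - R x = smul l (R (orbit_int h 0 h x)) - orbit_int h 0 h x"
      using that orbit_int_A0[OF R_in_dom[of x], of 0 h h]
      by (simp add: A0_R blinfun.diff_right orbit_int_smul R_orbit_int)
    then have "\<phi> (T h (R x)) - \<phi> (R x) = l * \<phi> (R (orbit_int h 0 h x)) - \<phi> (orbit_int h 0 h x)"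
      by (simp add: dual_spaceD[OF sun_dualD[OF \<phi>]] flip: blinfun.diff_right)
        (simp add: blinfun.diff_right dual_spaceD[OF sun_dualD[OF \<phi>]])
    with that show "(adj T h (\<phi> o\<^sub>L R) - (\<phi> o\<^sub>L R)) x = (?\<psi> o\<^sub>L orbit_int h 0 h) x"
      by (simp add: blinfun.diff_left R_T)
  qed
  then have "\<forall>\<^sub>F h in at_right 0. (?\<psi> o\<^sub>L orbit_int h 0 h) /\<^sub>R h = (adj T h (\<phi> o\<^sub>L R) - (\<phi> o\<^sub>L R)) /\<^sub>R h"
    unfolding eventually_at_right_field by (intro exI[of _ 1]) auto
  then have "((\<lambda>h. (adj T h (\<phi> o\<^sub>L R) - (\<phi> o\<^sub>L R)) /\<^sub>R h) \<longlongrightarrow> ?\<psi>) (at_right 0)"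
    by (rule Lim_transform_eventually[OF sun_average[OF \<psi>]])
  with R_sun \<psi> show "\<phi> o\<^sub>L R \<in> A0_sun_dom smul T" "A0_sun T (\<phi> o\<^sub>L R) = ?\<psi>"
    by (auto intro: generator_domI generator_eqI)
qed

text \<open>
  A norm limit in the dual can be evaluated pointwise on the vectors \<open>R x\<close>, which lie in the domain of
  \<open>A0 T\<close>.  Together with \<open>A0_sun_R\<close>: the domain of the generator on the sun dual consists of the
  functionals \<open>\<phi> \<circ> R\<close>.
\<close>
lemma A0_sun_resolvent:
  assumes \<psi>: "\<psi> \<in> A0_sun_dom smul T"
  shows "(dual_scale l \<psi> - A0_sun T \<psi>) o\<^sub>L R = \<psi>"
proof (rule blinfun_eqI)
  fix x
  have "\<psi> \<in> dual_space smul"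
    using \<psi> by (auto simp: generator_dom_def sun_dual_def)
  have "((\<lambda>h. blinfun_apply ((adj T h \<psi> - \<psi>) /\<^sub>R h) (R x)) \<longlongrightarrow> A0_sun T \<psi> (R x)) (at_right 0)"
    by (intro bounded_linear.tendsto[OF blinfun.bounded_linear_left] generator_tendsto[OF \<psi>])
  moreover have "((\<lambda>h. \<psi> ((T h (R x) - R x) /\<^sub>R h)) \<longlongrightarrow> \<psi> (A0 T (R x))) (at_right 0)"
    by (intro bounded_linear.tendsto[OF blinfun.bounded_linear_right] A0_tendsto R_in_dom)
  moreover have "blinfun_apply ((adj T h \<psi> - \<psi>) /\<^sub>R h) (R x) = \<psi> ((T h (R x) - R x) /\<^sub>R h)" for h
    by (simp add: blinfun.diff_left blinfun.diff_right blinfun.scaleR_left blinfun.scaleR_right)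
  ultimately have "A0_sun T \<psi> (R x) = \<psi> (A0 T (R x))"
    using tendsto_unique[OF trivial_limit_at_right_real] by simp
  then show "((dual_scale l \<psi> - A0_sun T \<psi>) o\<^sub>L R) x = \<psi> x"
    using dual_spaceD[OF \<open>\<psi> \<in> dual_space smul\<close>]
    by (simp add: blinfun.diff_left blinfun.diff_right A0_R)
qed

text \<open>
  Density of the domain: every \<open>\<phi>\<close> is the norm limit of its averages, which have the form \<open>\<eta> \<circ> R\<close> with
  \<open>\<eta>\<close> in the sun dual.  This makes the adjoint of the generator single-valued.
\<close>
lemma star_eqI:
  assumes F: "F \<in> star" and H: "H \<in> star" and eq: "\<And>\<phi>. \<phi> \<in> sun \<Longrightarrow> F (\<phi> o\<^sub>L R) = H (\<phi> o\<^sub>L R)"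
  shows "F = H"
proof
  fix \<phi>
  show "F \<phi> = H \<phi>"
  proof (cases "\<phi> \<in> sun")
    case True
    let ?f = "\<lambda>h. (\<phi> o\<^sub>L orbit_int h 0 h) /\<^sub>R h"
    have sun: "\<forall>\<^sub>F h in at_right 0. ?f h \<in> sun"
      unfolding eventually_at_right_field
      by (intro exI[of _ 1]) (auto intro!: sun_dual_scaleR sun_orbit_int True)
    have "F (\<phi> o\<^sub>L orbit_int h 0 h) = H (\<phi> o\<^sub>L orbit_int h 0 h)" if "h > 0" for h
      using eq[OF orbit_int_preimage_sun[OF True, of 0 h h]] that
      by (simp add: orbit_int_preimage_R sun_dualD True)
    then have "F (?f h) = H (?f h)" if "h > 0" for h
      using that sun_orbit_int[OF True, of 0 h h] by (simp add: star_scaleR[OF F] star_scaleR[OF H])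
    then have "\<forall>\<^sub>F h in at_right 0. F (?f h) = H (?f h)"
      unfolding eventually_at_right_field by (intro exI[of _ 1]) auto
    from Lim_transform_eventually[OF star_tendsto[OF F sun_average[OF True] True sun] this]
    show ?thesis
      using star_tendsto[OF H sun_average[OF True] True sun]
      by (rule tendsto_unique[OF trivial_limit_at_right_real])
  next
    case False
    then show ?thesis using F H by (simp add: star_outside)
  qed
qed

text \<open>The second adjoint of \<open>R\<close>, with the value 0 outside the sun dual.\<close>
definition R_star :: "(('a \<Rightarrow>\<^sub>L 'k) \<Rightarrow> 'k) \<Rightarrow> ('a \<Rightarrow>\<^sub>L 'k) \<Rightarrow> 'k" where
  "R_star F \<phi> = (if \<phi> \<in> sun then F (\<phi> o\<^sub>L R) else 0)"

lemma R_sun: "\<phi> \<in> sun \<Longrightarrow> \<phi> o\<^sub>L R \<in> sun"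
  by (intro dual_R_sun sun_dualD)

lemma R_star_in_star:
  assumes F: "F \<in> star"
  shows "R_star F \<in> star"
proof -
  obtain C where C: "C > 0" "\<And>\<phi>. \<phi> \<in> sun \<Longrightarrow> norm (F \<phi>) \<le> C * norm \<phi>"
    using star_bound[OF F] by blast
  have "norm (F (\<phi> o\<^sub>L R)) \<le> C * norm R * norm \<phi>" if "\<phi> \<in> sun" for \<phi>
  proof -
    have "norm (F (\<phi> o\<^sub>L R)) \<le> C * norm (\<phi> o\<^sub>L R)"
      by (intro C R_sun that)
    also have "\<dots> \<le> C * (norm \<phi> * norm R)"
      using C(1) by (intro mult_left_mono norm_blinfun_compose) auto
    finally show ?thesis by (simp add: mult_ac)
  qed
  then have "\<exists>C. \<forall>\<phi>\<in>sun. norm (R_star F \<phi>) \<le> C * norm \<phi>"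
    by (auto simp: R_star_def)
  moreover have "R_star F (\<phi> + \<psi>) = R_star F \<phi> + R_star F \<psi>" if "\<phi> \<in> sun" "\<psi> \<in> sun" for \<phi> \<psi>
  proof -
    have "(\<phi> + \<psi>) o\<^sub>L R = (\<phi> o\<^sub>L R) + (\<psi> o\<^sub>L R)"
      by (rule blinfun_eqI) (simp add: blinfun.add_left)
    with that show ?thesis
      by (simp add: R_star_def star_add[OF F] R_sun subspace_add[OF subspace_sun])
  qed
  moreover have "R_star F (dual_scale k \<phi>) = k * R_star F \<phi>" if "\<phi> \<in> sun" for k \<phi>
  proof -
    have "dual_scale k \<phi> o\<^sub>L R = dual_scale k (\<phi> o\<^sub>L R)"
      by (rule blinfun_eqI) simp
    with that show ?thesis
      by (simp add: R_star_def star_scale[OF F] R_sun dual_scale_sun)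
  qed
  ultimately show ?thesis
    unfolding sun_star_def by (simp add: R_star_def)
qed

lemma A0_sun_star_eq: "A0_sun_star_rel smul T F H \<Longrightarrow> A0_sun_star smul T F = H"
  unfolding A0_sun_star_def
proof (rule the_equality)
  fix H' assume rel: "A0_sun_star_rel smul T F H" "A0_sun_star_rel smul T F H'"
  then show "H' = H"
    by (intro star_eqI) (auto simp: A0_sun_star_rel_def A0_sun_R)
qed

lemma A0_sun_star_R_star:
  assumes F: "F \<in> star"
  shows "A0_sun_star_rel smul T (R_star F) (\<lambda>\<phi>. l * R_star F \<phi> - F \<phi>)"
  unfolding A0_sun_star_rel_def
proof (intro conjI ballI)
  show "R_star F \<in> star" by (rule R_star_in_star[OF F])
  show "(\<lambda>\<phi>. l * R_star F \<phi> - F \<phi>) \<in> star"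
    using star_combine[OF R_star_in_star[OF F] F, of l "- 1"] by simp
  fix \<psi> assume \<psi>: "\<psi> \<in> A0_sun_dom smul T"
  then have sun: "\<psi> \<in> sun" "A0_sun T \<psi> \<in> sun"
    using generator_in by (auto simp: generator_dom_def)
  have "dual_scale l (\<psi> o\<^sub>L R) - (A0_sun T \<psi> o\<^sub>L R) = \<psi>"
    by (subst (3) A0_sun_resolvent[OF \<psi>, symmetric]) (rule blinfun_eqI, simp add: blinfun.diff_left)
  then have "F \<psi> = F (dual_scale l (\<psi> o\<^sub>L R) - (A0_sun T \<psi> o\<^sub>L R))" by simp
  also have "\<dots> = l * F (\<psi> o\<^sub>L R) - F (A0_sun T \<psi> o\<^sub>L R)"
    by (simp add: star_diff[OF F] star_scale[OF F] dual_scale_sun R_sun sun)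
  finally show "l * R_star F \<psi> - F \<psi> = R_star F (A0_sun T \<psi>)"
    by (simp add: R_star_def sun)
qed

text \<open>
  \<open>R_star F\<close> solves the resolvent equation by \<open>A0_sun_star_R_star\<close>, and \<open>R_star\<close> is also a left inverse,
  so the inverse chosen by \<open>inv_into\<close> is unique.
\<close>
lemma sun_star_resolvent_eq:
  assumes F: "F \<in> star"
  shows "sun_star_resolvent smul T l F = R_star F"
  unfolding sun_star_resolvent_def
proof (rule inv_into_f_eq)
  show "R_star F \<in> A0_sun_star_dom smul T"
    using A0_sun_star_R_star[OF F] by (auto simp: A0_sun_star_dom_def)
  show "(\<lambda>\<phi>. l * R_star F \<phi> - A0_sun_star smul T (R_star F) \<phi>) = F"
    by (simp add: A0_sun_star_eq[OF A0_sun_star_R_star[OF F]])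
  show "inj_on (\<lambda>G \<phi>. l * G \<phi> - A0_sun_star smul T G \<phi>) (A0_sun_star_dom smul T)"
  proof (rule inj_on_inverseI)
    fix G assume "G \<in> A0_sun_star_dom smul T"
    then obtain H where rel: "A0_sun_star_rel smul T G H"
      by (auto simp: A0_sun_star_dom_def)
    then have G: "G \<in> star" and H: "\<And>\<phi>. \<phi> \<in> sun \<Longrightarrow> H (\<phi> o\<^sub>L R) = G (A0_sun T (\<phi> o\<^sub>L R))"
      by (auto simp: A0_sun_star_rel_def A0_sun_R)
    have "l * G (\<phi> o\<^sub>L R) - H (\<phi> o\<^sub>L R) = G \<phi>" if "\<phi> \<in> sun" for \<phi>
      by (simp add: H that A0_sun_R star_diff[OF G] star_scale[OF G] dual_scale_sun R_sun)
    then show "R_star (\<lambda>\<phi>. l * G \<phi> - A0_sun_star smul T G \<phi>) = G"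
      by (auto simp: R_star_def A0_sun_star_eq[OF rel] star_outside[OF G])
  qed
qed

lemma sun_cross_iff:
  "F \<in> sun_cross smul T l \<longleftrightarrow> F \<in> star \<and> (\<exists>z. \<forall>\<phi>\<in>sun. F (\<phi> o\<^sub>L R) = \<phi> z)"
  by (auto simp: sun_cross_def sun_star_resolvent_eq R_star_def[abs_def] sun_embed_def fun_eq_iff)
    metis+

section \<open>Admissible ranges\<close>

text \<open>
  Orbit integrals have the form \<open>\<eta> \<circ> R\<close> for an explicit \<open>\<eta>\<close>, on which \<open>F\<close> is evaluation at \<open>z\<close>; and \<open>\<eta> z\<close>
  is \<open>\<phi>\<close> evaluated at a vector that depends only on \<open>z\<close>.
\<close>
lemma sun_cross_orbit_int:
  assumes F: "F \<in> sun_cross smul T l" and ab: "a \<le> b" "b \<le> t"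
  shows "\<exists>x. \<forall>\<phi>\<in>sun. F (\<phi> o\<^sub>L orbit_int t a b) = \<phi> x"
proof -
  obtain z where z: "\<And>\<phi>. \<phi> \<in> sun \<Longrightarrow> F (\<phi> o\<^sub>L R) = \<phi> z"
    using F by (auto simp: sun_cross_iff)
  have "F (\<phi> o\<^sub>L orbit_int t a b) = \<phi> (smul l (orbit_int t a b z) - (T (t - a) z - T (t - b) z))"
    if \<phi>: "\<phi> \<in> sun" for \<phi>
  proof -
    have "F (\<phi> o\<^sub>L orbit_int t a b) = orbit_int_preimage t a b \<phi> z"
      using z[OF orbit_int_preimage_sun[OF \<phi> ab]] by (simp add: orbit_int_preimage_R sun_dualD \<phi> ab)
    then show ?thesis
      by (simp add: orbit_int_preimage_def blinfun.diff_left blinfun.diff_right dual_spaceD[OF sun_dualD[OF \<phi>]])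
  qed
  then show ?thesis by blast
qed

text \<open>
  On a short interval around \<open>\<tau>\<close> the function \<open>f\<close> may be replaced by the constant \<open>f \<tau>\<close>, for which
  \<open>sun_cross_orbit_int\<close> provides \<open>x\<close>.  The error bound is additive over adjacent intervals, so that
  bisection carries it from short intervals to \<open>{s..t}\<close>.
\<close>
lemma orbit_integral_approx:
  fixes f :: "real \<Rightarrow> ('a \<Rightarrow>\<^sub>L 'k) \<Rightarrow> 'k"
  assumes st: "s \<le> t"
    and f: "\<And>\<tau>. \<tau> \<in> {s..t} \<Longrightarrow> f \<tau> \<in> sun_cross smul T l"
      "\<And>\<tau>. \<tau> \<in> {s..t} \<Longrightarrow> ((\<lambda>\<sigma>. sun_star_dist smul T (f \<tau>) (f \<sigma>)) \<longlongrightarrow> 0) (at \<tau> within {s..t})"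
    and M: "\<And>r. 0 \<le> r \<Longrightarrow> r \<le> t - s \<Longrightarrow> norm (T r) \<le> M" and e: "e > 0"
  shows "\<exists>x. \<forall>\<phi>\<in>sun. norm (integral {s..t} (\<lambda>\<tau>. f \<tau> (adj T (t - \<tau>) \<phi>)) - \<phi> x)
    \<le> e * (M * norm \<phi>) * (t - s)"
proof -
  have star: "f \<tau> \<in> star" if "\<tau> \<in> {s..t}" for \<tau>
    using f(1)[OF that] by (simp add: sun_cross_iff)
  have cont: "continuous_on {a..b} (\<lambda>\<tau>. f \<tau> (adj T (t - \<tau>) \<phi>))" if "\<phi> \<in> sun" "s \<le> a" "b \<le> t" for a b \<phi>
    by (rule continuous_on_subset[OF continuous_star_valued_orbit[OF star f(2)]]) (use that in auto)
  let ?I = "\<lambda>a b \<phi>. integral {a..b} (\<lambda>\<tau>. f \<tau> (adj T (t - \<tau>) \<phi>))"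
  define P where "P a b \<longleftrightarrow> (s \<le> a \<longrightarrow> a \<le> b \<longrightarrow> b \<le> t \<longrightarrow>
    (\<exists>x. \<forall>\<phi>\<in>sun. norm (?I a b \<phi> - \<phi> x) \<le> e * (M * norm \<phi>) * (b - a)))" for a b
  have "P s t"
    using st
  proof (induction rule: Bolzano)
    case (trans a b c)
    show ?case
      unfolding P_def
    proof (intro impI)
      assume ac: "s \<le> a" "c \<le> t"
      with trans obtain x y where
        x: "\<And>\<phi>. \<phi> \<in> sun \<Longrightarrow> norm (?I a b \<phi> - \<phi> x) \<le> e * (M * norm \<phi>) * (b - a)" and
        y: "\<And>\<phi>. \<phi> \<in> sun \<Longrightarrow> norm (?I b c \<phi> - \<phi> y) \<le> e * (M * norm \<phi>) * (c - b)"
        unfolding P_def by (meson order_trans)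
      have "norm (?I a c \<phi> - \<phi> (x + y)) \<le> e * (M * norm \<phi>) * (c - a)" if \<phi>: "\<phi> \<in> sun" for \<phi>
      proof -
        have "?I a c \<phi> = ?I a b \<phi> + ?I b c \<phi>"
          using trans ac by (intro Henstock_Kurzweil_Integration.integral_combine[symmetric] integrable_continuous_real cont \<phi>)
        then have "?I a c \<phi> - \<phi> (x + y) = (?I a b \<phi> - \<phi> x) + (?I b c \<phi> - \<phi> y)"
          by (simp add: blinfun.add_right)
        also have "norm \<dots> \<le> e * (M * norm \<phi>) * (b - a) + e * (M * norm \<phi>) * (c - b)"
          by (intro norm_triangle_mono x y \<phi>)
        finally show ?thesis by (simp add: algebra_simps)
      qed
      then show "\<exists>x. \<forall>\<phi>\<in>sun. norm (?I a c \<phi> - \<phi> x) \<le> e * (M * norm \<phi>) * (c - a)" by blast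
    qed
  next
    case (local \<tau>)
    then have \<tau>: "\<tau> \<in> {s..t}" by simp
    obtain d where d: "d > 0" "\<And>\<sigma>. \<sigma> \<in> {s..t} \<Longrightarrow> \<sigma> \<noteq> \<tau> \<Longrightarrow> dist \<sigma> \<tau> < d \<Longrightarrow>
        dist (sun_star_dist smul T (f \<tau>) (f \<sigma>)) 0 < e"
      using tendstoD[OF f(2)[OF \<tau>] e] unfolding eventually_at by blast
    have "P a b" if ab: "a \<le> \<tau>" "\<tau> \<le> b" "b - a < d" for a b
      unfolding P_def
    proof (intro impI)
      assume ab': "s \<le> a" "a \<le> b" "b \<le> t"
      obtain x where x: "\<And>\<phi>. \<phi> \<in> sun \<Longrightarrow> f \<tau> (\<phi> o\<^sub>L orbit_int t a b) = \<phi> x"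
        using sun_cross_orbit_int[OF f(1)[OF \<tau>]] ab' by blast
      have "norm (?I a b \<phi> - \<phi> x) \<le> e * (M * norm \<phi>) * (b - a)" if \<phi>: "\<phi> \<in> sun" for \<phi>
      proof -
        have const: "((\<lambda>\<sigma>. f \<tau> (adj T (t - \<sigma>) \<phi>)) has_integral \<phi> x) {a..b}"
          using integral_star_orbit[OF star[OF \<tau>] \<phi> ab'(2,3)] by (simp add: x \<phi>)
        have self: "sun_star_dist smul T (f \<tau>) (f \<tau>) = 0"
          using star[OF \<tau>] by (simp add: Metric_space.mdist_zero[OF Metric_space_sun_star])
        have const_cont: "continuous_on {a..b} (\<lambda>\<sigma>. f \<tau> (adj T (t - \<sigma>) \<phi>))"
          by (rule continuous_on_subset[OF continuous_star_valued_orbit[of s t "\<lambda>_. f \<tau>"]])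
            (use ab' \<phi> star \<tau> self in auto)
        have "?I a b \<phi> - \<phi> x
            = integral {a..b} (\<lambda>\<sigma>. f \<sigma> (adj T (t - \<sigma>) \<phi>) - f \<tau> (adj T (t - \<sigma>) \<phi>))"
          using const ab' by (simp add: has_integral_iff integral_diff integrable_continuous_real cont \<phi>)
        also have "norm \<dots> \<le> e * (M * norm \<phi>) * (b - a)"
        proof (rule integral_bound)
          show "continuous_on {a..b} (\<lambda>\<sigma>. f \<sigma> (adj T (t - \<sigma>) \<phi>) - f \<tau> (adj T (t - \<sigma>) \<phi>))"
            using ab' by (intro continuous_on_diff cont const_cont \<phi>)
          fix \<sigma> assume \<sigma>: "\<sigma> \<in> {a..b}"
          then have \<sigma>': "\<sigma> \<in> {s..t}" using ab' by auto
          have "M * norm \<phi> \<ge> 0"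
            using order_trans[OF norm_ge_zero M[of 0]] st by simp
          show "norm (f \<sigma> (adj T (t - \<sigma>) \<phi>) - f \<tau> (adj T (t - \<sigma>) \<phi>)) \<le> e * (M * norm \<phi>)"
          proof (cases "\<sigma> = \<tau>")
            case True
            with \<open>M * norm \<phi> \<ge> 0\<close> e show ?thesis by simp
          next
            case False
            have "norm (f \<sigma> (adj T (t - \<sigma>) \<phi>) - f \<tau> (adj T (t - \<sigma>) \<phi>))
                = norm (f \<tau> (adj T (t - \<sigma>) \<phi>) - f \<sigma> (adj T (t - \<sigma>) \<phi>))"
              by (rule norm_minus_commute)
            also have "\<dots> \<le> sun_star_dist smul T (f \<tau>) (f \<sigma>) * norm (adj T (t - \<sigma>) \<phi>)"
              using \<sigma>' by (intro star_dist_bound star \<tau> adj_sun \<phi>) auto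
            also have "\<dots> \<le> e * (M * norm \<phi>)"
            proof (intro mult_mono norm_adj_le M)
              show "sun_star_dist smul T (f \<tau>) (f \<sigma>) \<le> e"
                using d(2)[OF \<sigma>' False] \<sigma> ab unfolding dist_real_def by force
            qed (use \<sigma>' e in auto)
            finally show ?thesis .
          qed
        qed (use ab' in simp)
        finally show ?thesis .
      qed
      then show "\<exists>x. \<forall>\<phi>\<in>sun. norm (?I a b \<phi> - \<phi> x) \<le> e * (M * norm \<phi>) * (b - a)" by blast
    qed
    with d(1) show ?case by blast
  qed
  then show ?thesis
    using st by (simp add: P_def)
qed

lemma orbit_integral_in_embed:
  fixes f :: "real \<Rightarrow> ('a \<Rightarrow>\<^sub>L 'k) \<Rightarrow> 'k"
  assumes st: "s \<le> t"
    and f: "\<And>\<tau>. \<tau> \<in> {s..t} \<Longrightarrow> f \<tau> \<in> sun_cross smul T l"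
      "\<And>\<tau>. \<tau> \<in> {s..t} \<Longrightarrow> ((\<lambda>\<sigma>. sun_star_dist smul T (f \<tau>) (f \<sigma>)) \<longlongrightarrow> 0) (at \<tau> within {s..t})"
  shows "\<exists>x. \<forall>\<phi>\<in>sun. integral {s..t} (\<lambda>\<tau>. f \<tau> (adj T (t - \<tau>) \<phi>)) = \<phi> x"
proof (rule embed_range_closed)
  obtain M where M: "M > 0" "\<And>r. 0 \<le> r \<Longrightarrow> r \<le> t - s \<Longrightarrow> norm (T r) \<le> M"
    using T_locally_bounded by blast
  fix e :: real assume e: "e > 0"
  \<comment> \<open>The summand 1 avoids a division by zero when \<open>s = t\<close>.\<close>
  define d where "d = e / (M * (t - s + 1))"
  have pos: "M * (t - s + 1) > 0" using M(1) st by (intro mult_pos_pos) auto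
  then have "d > 0" unfolding d_def using e by (rule divide_pos_pos[rotated])
  have d: "d * (M * (t - s + 1)) = e"
    by (metis d_def less_irrefl nonzero_eq_divide_eq pos)
  from orbit_integral_approx[OF st f M(2) \<open>d > 0\<close>] obtain x where
    x: "\<And>\<phi>. \<phi> \<in> sun \<Longrightarrow> norm (integral {s..t} (\<lambda>\<tau>. f \<tau> (adj T (t - \<tau>) \<phi>)) - \<phi> x) \<le> d * (M * norm \<phi>) * (t - s)"
    by blast
  have "d * (M * norm \<phi>) * (t - s) \<le> e * norm \<phi>" for \<phi> :: "'a \<Rightarrow>\<^sub>L 'k"
  proof -
    have "d * (M * norm \<phi>) * (t - s) \<le> d * (M * norm \<phi>) * (t - s + 1)"
      using M(1) \<open>d > 0\<close> by (intro mult_left_mono) auto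
    also have "\<dots> = e * norm \<phi>" unfolding d[symmetric] by (simp add: mult_ac)
    finally show ?thesis .
  qed
  with x show "\<exists>x. \<forall>\<phi>\<in>sun. norm (integral {s..t} (\<lambda>\<tau>. f \<tau> (adj T (t - \<tau>) \<phi>)) - \<phi> x) \<le> e * norm \<phi>"
    by (meson order_trans)
qed

text \<open>
  If \<open>u\<close> represents the orbit integral of \<open>F\<close> over an interval of length \<open>h\<close>, then \<open>R u / h\<close> represents
  \<open>\<phi> \<mapsto> F (\<phi> \<circ> R)\<close> up to an error of order \<open>h\<close>: the resolvent can be moved under the integral, where
  \<open>T_R_lipschitz\<close> applies.
\<close>
lemma sun_cross_if_short_integrals:
  assumes F: "F \<in> star" and d: "d > 0"
    and int: "\<And>h. 0 < h \<Longrightarrow> h < d \<Longrightarrow> \<exists>x. \<forall>\<phi>\<in>sun. F (\<phi> o\<^sub>L orbit_int (a + h) a (a + h)) = \<phi> x"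
  shows "F \<in> sun_cross smul T l"
  unfolding sun_cross_iff
proof (intro conjI F embed_range_closed)
  obtain C where C: "C > 0" "\<And>\<phi>. \<phi> \<in> sun \<Longrightarrow> norm (F \<phi>) \<le> C * norm \<phi>"
    using star_bound[OF F] by blast
  obtain K where K: "K \<ge> 0" "\<And>h. 0 \<le> h \<Longrightarrow> h \<le> 1 \<Longrightarrow> norm ((T h o\<^sub>L R) - R) \<le> K * h"
    using T_R_lipschitz by blast
  fix e :: real assume e: "e > 0"
  \<comment> \<open>\<open>h < d\<close> gives access to the integrals, \<open>h \<le> 1\<close> to the Lipschitz bound; the last term makes the error \<open>C * K * h\<close> at most \<open>e\<close>.\<close>
  define h where "h = min (min (d / 2) 1) (e / (C * (K + 1)))"
  have CK: "C * (K + 1) > 0" using C(1) K(1) by (intro mult_pos_pos) auto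
  then have h: "0 < h" "h < d" "h \<le> 1"
    using e d by (auto simp: h_def)
  have "C * (K * h) \<le> C * (K + 1) * h"
    using C(1) h by (simp add: algebra_simps)
  also have "\<dots> \<le> C * (K + 1) * (e / (C * (K + 1)))"
    using CK by (intro mult_left_mono) (auto simp: h_def)
  also have "\<dots> = e"
    by (metis CK less_irrefl mult.commute nonzero_eq_divide_eq)
  finally have CKh: "C * (K * h) \<le> e" .
  let ?V = "orbit_int (a + h) a (a + h)"
  obtain u where u: "\<And>\<phi>. \<phi> \<in> sun \<Longrightarrow> F (\<phi> o\<^sub>L ?V) = \<phi> u"
    using int[OF h(1,2)] by blast
  have diff: "norm ((R o\<^sub>L ?V) - h *\<^sub>R R) \<le> K * h * h"
  proof (rule norm_blinfun_bound)
    fix x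
    have "R (?V x) = integral {a..a + h} (\<lambda>\<tau>. T (a + h - \<tau>) (R x))"
      using h by (subst R_orbit_int) (auto simp: orbit_int_apply)
    then have "R (?V x) - h *\<^sub>R R x = integral {a..a + h} (\<lambda>\<tau>. T (a + h - \<tau>) (R x) - R x)"
      using h by (subst integral_diff) (auto simp: integrable_T_reversed)
    also have "norm \<dots> \<le> K * h * norm x * (a + h - a)"
    proof (rule integral_bound)
      show "continuous_on {a..a + h} (\<lambda>\<tau>. T (a + h - \<tau>) (R x) - R x)"
        by (intro continuous_intros continuous_T_reversed) simp
      fix \<tau> assume \<tau>: "\<tau> \<in> {a..a + h}"
      have "norm (T (a + h - \<tau>) (R x) - R x) = norm (((T (a + h - \<tau>) o\<^sub>L R) - R) x)"
        by (simp add: blinfun.diff_left)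
      also have "\<dots> \<le> norm ((T (a + h - \<tau>) o\<^sub>L R) - R) * norm x"
        by (rule norm_blinfun)
      also have "\<dots> \<le> K * (a + h - \<tau>) * norm x"
        using \<tau> h by (intro mult_right_mono K(2)) auto
      also have "\<dots> \<le> K * h * norm x"
        using \<tau> K(1) by (intro mult_right_mono mult_left_mono) auto
      finally show "norm (T (a + h - \<tau>) (R x) - R x) \<le> K * h * norm x" .
    qed (use h in simp)
    finally show "norm (((R o\<^sub>L ?V) - h *\<^sub>R R) x) \<le> K * h * h * norm x"
      by (simp add: blinfun.diff_left blinfun.scaleR_left mult_ac)
  qed (use K(1) h in simp)
  have "norm (F (\<phi> o\<^sub>L R) - \<phi> (R u /\<^sub>R h)) \<le> e * norm \<phi>" if \<phi>: "\<phi> \<in> sun" for \<phi>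
  proof -
    have RV: "(\<phi> o\<^sub>L R) o\<^sub>L ?V \<in> sun"
      using h by (intro sun_orbit_int R_sun \<phi>) auto
    have eq: "((\<phi> o\<^sub>L R) o\<^sub>L ?V) - h *\<^sub>R (\<phi> o\<^sub>L R) = \<phi> o\<^sub>L ((R o\<^sub>L ?V) - h *\<^sub>R R)"
      by (rule blinfun_eqI)
        (simp add: blinfun.diff_left blinfun.diff_right blinfun.scaleR_left blinfun.scaleR_right)
    have "\<phi> (R u) - h *\<^sub>R F (\<phi> o\<^sub>L R) = F (((\<phi> o\<^sub>L R) o\<^sub>L ?V) - h *\<^sub>R (\<phi> o\<^sub>L R))"
      using u[OF R_sun[OF \<phi>]]
      by (simp add: star_diff[OF F] star_scaleR[OF F] RV R_sun \<phi> sun_dual_scaleR)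
    also have "norm \<dots> \<le> C * norm (((\<phi> o\<^sub>L R) o\<^sub>L ?V) - h *\<^sub>R (\<phi> o\<^sub>L R))"
      by (intro C subspace_diff[OF subspace_sun] RV sun_dual_scaleR R_sun \<phi>)
    also have "\<dots> \<le> C * (norm \<phi> * (K * h * h))"
      unfolding eq using C(1)
      by (intro mult_left_mono order_trans[OF norm_blinfun_compose] diff) auto
    also have "\<dots> = C * (K * h) * (norm \<phi> * h)"
      by (simp add: mult_ac)
    also have "\<dots> \<le> e * (norm \<phi> * h)"
      using h by (intro mult_right_mono CKh) auto
    finally have *: "norm (\<phi> (R u) - h *\<^sub>R F (\<phi> o\<^sub>L R)) \<le> e * norm \<phi> * h"
      by (simp add: mult_ac)
    have "F (\<phi> o\<^sub>L R) - \<phi> (R u /\<^sub>R h) = - ((\<phi> (R u) - h *\<^sub>R F (\<phi> o\<^sub>L R)) /\<^sub>R h)"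
      using h by (simp add: blinfun.scaleR_right scaleR_diff_right)
    then have "norm (F (\<phi> o\<^sub>L R) - \<phi> (R u /\<^sub>R h)) = norm (\<phi> (R u) - h *\<^sub>R F (\<phi> o\<^sub>L R)) / h"
      using h by (simp add: divide_inverse mult.commute)
    also have "\<dots> \<le> e * norm \<phi>"
      using * h by (simp add: divide_le_eq)
    finally show ?thesis .
  qed
  then show "\<exists>x. \<forall>\<phi>\<in>sun. norm (F (\<phi> o\<^sub>L R) - \<phi> x) \<le> e * norm \<phi>" by blast
qed

lemma weak_star_integral_orbit_in_embed_iff:
  "weak_star_integral smul T s t (\<lambda>\<tau>. sun_star_semigroup smul T (t - \<tau>) (f \<tau>)) \<in> range (sun_embed smul T)
    \<longleftrightarrow> (\<exists>x. \<forall>\<phi>\<in>sun. integral {s..t} (\<lambda>\<tau>. f \<tau> (adj T (t - \<tau>) \<phi>)) = \<phi> x)"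
proof -
  have "weak_star_integral smul T s t (\<lambda>\<tau>. sun_star_semigroup smul T (t - \<tau>) (f \<tau>)) = sun_embed smul T x
      \<longleftrightarrow> (\<forall>\<phi>\<in>sun. integral {s..t} (\<lambda>\<tau>. f \<tau> (adj T (t - \<tau>) \<phi>)) = \<phi> x)" for x
    unfolding weak_star_integral_def sun_star_semigroup_def sun_embed_def fun_eq_iff
    by (simp cong: if_cong) metis
  then show ?thesis
    by (simp add: image_iff)
qed

text \<open>Constant functions already detect membership in \<open>sun_cross\<close>, on whichever interval \<open>J\<close> admissibility is given.\<close>
lemma admissible_range_subset_sun_cross:
  assumes W: "admissible_range smul T W"
  shows "W \<subseteq> sun_cross smul T l"
proof
  fix F assume FW: "F \<in> W"
  have W': "closed_subspace_sun_star smul T W"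
    using W by (simp add: admissible_range_def)
  then have F: "F \<in> star"
    using FW by (auto simp: closed_subspace_sun_star_def)
  from W obtain J where J: "is_interval J" "\<exists>a\<in>J. \<exists>b\<in>J. a < b" and
    int: "\<forall>f. continuous_map (top_of_set J) (sun_star_topology smul T) f \<and> f ` J \<subseteq> W \<longrightarrow>
      (\<forall>s\<in>J. \<forall>t\<in>J. s \<le> t \<longrightarrow>
        weak_star_integral smul T s t (\<lambda>\<tau>. sun_star_semigroup smul T (t - \<tau>) (f \<tau>))
          \<in> range (sun_embed smul T))"
    unfolding admissible_range_def by (elim conjE exE)
  from J(2) obtain a b where ab: "a \<in> J" "b \<in> J" "a < b"
    by blast
  show "F \<in> sun_cross smul T l"
  proof (rule sun_cross_if_short_integrals[OF F])
    show "b - a > 0" using ab by simp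
    fix h assume h: "0 < h" "h < b - a"
    have "a + h \<in> J"
      by (rule mem_is_interval_1_I[OF J(1) ab(1,2)]) (use h in auto)
    moreover have "topspace (sun_star_topology smul T) = star"
      unfolding sun_star_topology_def
      by (rule Metric_space.topspace_mtopology[OF Metric_space_sun_star])
    then have "continuous_map (top_of_set J) (sun_star_topology smul T) (\<lambda>_. F)"
      using F by simp
    ultimately have "\<exists>x. \<forall>\<phi>\<in>sun. integral {a..a + h} (\<lambda>\<tau>. F (adj T (a + h - \<tau>) \<phi>)) = \<phi> x"
      using int[rule_format, of "\<lambda>_. F" a "a + h"] ab FW h
      by (auto simp: weak_star_integral_orbit_in_embed_iff)
    then show "\<exists>x. \<forall>\<phi>\<in>sun. F (\<phi> o\<^sub>L orbit_int (a + h) a (a + h)) = \<phi> x"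
      using integral_unique[OF integral_star_orbit[OF F]] h by simp
  qed
qed

lemma closed_subspace_sun_cross: "closed_subspace_sun_star smul T (sun_cross smul T l)"
  unfolding closed_subspace_sun_star_def
proof (intro conjI ballI allI)
  show "sun_cross smul T l \<subseteq> star"
    by (auto simp: sun_cross_iff)
  show "(\<lambda>\<phi>. 0) \<in> sun_cross smul T l"
    by (auto simp: sun_cross_iff sun_star_def intro!: exI[of _ 0])
next
  fix F H assume "F \<in> sun_cross smul T l" "H \<in> sun_cross smul T l"
  then obtain y z where "F \<in> star" "H \<in> star"
    "\<And>\<phi>. \<phi> \<in> sun \<Longrightarrow> F (\<phi> o\<^sub>L R) = \<phi> y" "\<And>\<phi>. \<phi> \<in> sun \<Longrightarrow> H (\<phi> o\<^sub>L R) = \<phi> z"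
    by (auto simp: sun_cross_iff)
  then show "(\<lambda>\<phi>. F \<phi> + H \<phi>) \<in> sun_cross smul T l"
    using star_combine[of F H 1 1]
    by (auto simp: sun_cross_iff blinfun.add_right intro!: exI[of _ "y + z"])
next
  fix k F assume "F \<in> sun_cross smul T l"
  then obtain y where "F \<in> star" "\<And>\<phi>. \<phi> \<in> sun \<Longrightarrow> F (\<phi> o\<^sub>L R) = \<phi> y"
    by (auto simp: sun_cross_iff)
  then show "(\<lambda>\<phi>. k * F \<phi>) \<in> sun_cross smul T l"
    using star_combine[of F F k 0]
    by (auto simp: sun_cross_iff dual_spaceD[OF sun_dualD] intro!: exI[of _ "smul k y"])
next
  interpret Metric_space star "sun_star_dist smul T"
    by (rule Metric_space_sun_star)
  have limit: "F \<in> sun_cross smul T l"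
    if F: "F \<in> star" and near: "\<And>r. r > 0 \<Longrightarrow> \<exists>H\<in>sun_cross smul T l. sun_star_dist smul T F H < r" for F
    unfolding sun_cross_iff
  proof (intro conjI F embed_range_closed)
    fix e :: real assume e: "e > 0"
    define r where "r = e / (norm R + 1)"
    have pos: "norm R + 1 > 0" by (simp add: add_nonneg_pos)
    with e have r: "r > 0" and r_R: "r * (norm R + 1) = e" by (simp_all add: r_def)
    obtain H where H: "H \<in> sun_cross smul T l" "sun_star_dist smul T F H < r"
      using near[OF r] by blast
    then obtain z where H': "H \<in> star" and z: "\<And>\<phi>. \<phi> \<in> sun \<Longrightarrow> H (\<phi> o\<^sub>L R) = \<phi> z"
      by (auto simp: sun_cross_iff)
    have "norm (F (\<phi> o\<^sub>L R) - \<phi> z) \<le> e * norm \<phi>" if \<phi>: "\<phi> \<in> sun" for \<phi>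
    proof -
      have "norm (F (\<phi> o\<^sub>L R) - \<phi> z) \<le> sun_star_dist smul T F H * norm (\<phi> o\<^sub>L R)"
        using star_dist_bound[OF F H' R_sun[OF \<phi>]] by (simp add: z \<phi>)
      also have "\<dots> \<le> r * (norm \<phi> * norm R)"
        using H(2) r by (intro mult_mono norm_blinfun_compose) auto
      also have "\<dots> \<le> r * (norm \<phi> * (norm R + 1))"
        using r by (intro mult_left_mono) auto
      also have "\<dots> = e * norm \<phi>"
        unfolding r_R[symmetric] by (simp add: mult_ac)
      finally show ?thesis .
    qed
    then show "\<exists>x. \<forall>\<phi>\<in>sun. norm (F (\<phi> o\<^sub>L R) - \<phi> x) \<le> e * norm \<phi>" by blast
  qed
  have "\<exists>r>0. disjnt (sun_cross smul T l) (mball F r)" if "F \<in> star - sun_cross smul T l" for F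
  proof (rule ccontr)
    assume neg: "\<not> (\<exists>r>0. disjnt (sun_cross smul T l) (mball F r))"
    have "\<exists>H\<in>sun_cross smul T l. sun_star_dist smul T F H < r" if "r > 0" for r
    proof -
      from neg that have "\<not> disjnt (sun_cross smul T l) (mball F r)" by simp
      then show ?thesis by (auto simp: disjnt_iff)
    qed
    with that limit[of F] show False by simp
  qed
  then show "closedin (sun_star_topology smul T) (sun_cross smul T l)"
    unfolding sun_star_topology_def closedin_metric
    by (intro conjI allI impI) (auto simp: sun_cross_iff)
qed

lemma continuous_orbit_integral_in_embed:
  fixes f :: "real \<Rightarrow> ('a \<Rightarrow>\<^sub>L 'k) \<Rightarrow> 'k"
  assumes f: "continuous_map euclidean (sun_star_topology smul T) f" "range f \<subseteq> sun_cross smul T l"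
    and st: "s \<le> t"
  shows "weak_star_integral smul T s t (\<lambda>\<tau>. sun_star_semigroup smul T (t - \<tau>) (f \<tau>))
      \<in> range (sun_embed smul T)"
  unfolding weak_star_integral_orbit_in_embed_iff
proof (rule orbit_integral_in_embed[OF st])
  interpret Metric_space star "sun_star_dist smul T"
    by (rule Metric_space_sun_star)
  show "f \<tau> \<in> sun_cross smul T l" for \<tau>
    using f by blast
  show "((\<lambda>\<sigma>. sun_star_dist smul T (f \<tau>) (f \<sigma>)) \<longlongrightarrow> 0) (at \<tau> within {s..t})" for \<tau>
  proof (rule tendstoI)
    fix e :: real assume "e > 0"
    moreover have "continuous_map euclidean mtopology f"
      using f by (simp add: sun_star_topology_def)
    ultimately have "\<exists>U. open U \<and> \<tau> \<in> U \<and> (\<forall>\<sigma>\<in>U. f \<sigma> \<in> mball (f \<tau>) e)"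
      unfolding continuous_map_to_metric by (simp del: in_mball)
    then obtain U where "open U" "\<tau> \<in> U" "\<And>\<sigma>. \<sigma> \<in> U \<Longrightarrow> f \<sigma> \<in> mball (f \<tau>) e"
      by blast
    then show "\<forall>\<^sub>F \<sigma> in at \<tau> within {s..t}. dist (sun_star_dist smul T (f \<tau>) (f \<sigma>)) 0 < e"
      unfolding eventually_at_topological by auto
  qed
qed

lemma admissible_range_sun_cross: "admissible_range smul T (sun_cross smul T l)"
proof -
  have "\<exists>a\<in>UNIV. \<exists>b\<in>UNIV. a < (b :: real)"
    by (rule bexI[of _ 0], rule bexI[of _ 1]) simp_all
  moreover have "\<forall>f. continuous_map (top_of_set (UNIV :: real set)) (sun_star_topology smul T) f
      \<and> range f \<subseteq> sun_cross smul T l \<longrightarrow> (\<forall>s\<in>UNIV. \<forall>t\<in>UNIV. s \<le> t \<longrightarrow>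
        weak_star_integral smul T s t (\<lambda>\<tau>. sun_star_semigroup smul T (t - \<tau>) (f \<tau>))
          \<in> range (sun_embed smul T))"
    by (simp add: continuous_orbit_integral_in_embed)
  ultimately show ?thesis
    unfolding admissible_range_def
    by (intro conjI closed_subspace_sun_cross exI[of _ "UNIV :: real set"] is_interval_univ)
qed

end

theorem corollary14:
  fixes smul :: "'k::{real_normed_field,euclidean_space} \<Rightarrow> 'a::banach \<Rightarrow> 'a"
    and T :: "real \<Rightarrow> 'a \<Rightarrow>\<^sub>L 'a"
    and G :: "'a \<Rightarrow> ('a \<Rightarrow>\<^sub>L 'k) \<Rightarrow> 'k"
    and l :: 'k
  assumes "banach_scaling smul"
    and "c0_semigroup smul T"
    and "l \<in> resolvent_set smul (A0_dom T) (A0 T)"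
    and "continuous_map euclidean (sun_star_topology smul T) G"
  shows "admissible_perturbation smul T G \<longleftrightarrow> range G \<subseteq> sun_cross smul T l"
proof -
  interpret semigroup_resolvent smul T l
    by unfold_locales (rule assms)+
  show ?thesis
    unfolding admissible_perturbation_def
    using assms(4) admissible_range_subset_sun_cross admissible_range_sun_cross by blast
qed

end
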